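(* Let $\alpha=\alpha(x,y,z,p,q)$ be a smooth function of involutive type and of generic type, let $\mathcal I=\{dz-p\,dx-q\,dy,\ dp-\alpha\,dq\}_{\mathrm{diff}}$, let $\tilde{\mathcal I}$ be the reduced exterior differential system on the leaf space $J^1(2,1)/\mathrm{Ch}(\mathcal I)$, let $\pi\colon J^1(2,1)\to J^1(2,1)/\mathrm{Ch}(\mathcal I)$ be the projection, and let $p_0\in J^1(2,1)$. Then: (1) $\tilde{\mathcal I}$ is of type $(2,3)$ at $\pi(p_0)$ if and only if $\alpha$ satisfies, at $p_0$, $$\begin{cases}\alpha_p(\alpha_y+q\alpha_z)-\alpha(\alpha_y+q\alpha_z)_p-(\alpha_y+q\alpha_z)_q-\alpha_z=0,\\ \alpha_{yy}+2q\alpha_{yz}+q^2\alpha_{zz}=0.\end{cases}\qquad(\ast)$$ (2) $\tilde{\mathcal I}$ is of type $(2,3,4)$ at $\pi(p_0)$ if and only if $\alpha$ does not satisfy $(\ast)$ at $p_0$.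
   Context: All objects are $C^\infty$ and all considerations are local. $J^1(2,1)=PT^*J^0(2,1)$, where $J^0(2,1)$ is a three-dimensional manifold, with canonical local coordinates $(x,y,z,p,q)$ in which the contact form is $\omega_0=dz-p\,dx-q\,dy$. $\{\omega_1,\dots,\omega_r\}_{\mathrm{diff}}$ denotes the ideal of differential forms generated by the $\omega_i$ and $d\omega_i$. $\alpha$ is of involutive type if $\alpha_x+p\alpha_z-\alpha(\alpha_y+q\alpha_z)=0$ on its domain, and of generic type if $1+x(\alpha_y+q\alpha_z)\ne0$. $\mathrm{Ch}(\mathcal I)=\{X\in TJ^1(2,1):\iota_X(\mathcal I)\subset\mathcal I\}$ is the Cauchy characteristic system; for involutive $\alpha$ it is an integrable line field, and for generic $\alpha$ its (local) leaf space $J^1(2,1)/\mathrm{Ch}(\mathcal I)$ is a four-dimensional manifold $U_1$ with coordinates $$x_1=y+\alpha x,\quad x_2=z-px-qy,\quad x_3=p,\quad x_4=q,$$ and $\pi(x,y,z,p,q)=(x_1,x_2,x_3,x_4)$. The function $\alpha$ is constant along the leaves, so $\alpha=\overline\alpha\circ\pi$ for a function $\overline\alpha$ on $U_1$. The reduced system $\tilde{\mathcal I}$ (characterised by $\mathcal I=\{\pi^*\tilde{\mathcal I}\}_{\mathrm{alg}}$, the ideal generated by $\pi^*\tilde{\mathcal I}$) is $$\tilde{\mathcal I}=\{dx_2+x_1dx_4,\ dx_3-\overline\alpha\,dx_4\}_{\mathrm{diff}}.$$ Derived type. For a Pfaffian system generated (differentially) by local sections of a subbundle $J\subset T^*M$,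 the map $\theta\mapsto d\theta \bmod J$ induces a bundle map $\delta'\colon J\to\bigwedge^2(T^*M/J)$; put $J^{(1)}=\mathrm{Ker}\,\delta'$ (the first derived system), and inductively $J^{(k)}=(J^{(k-1)})^{(1)}$ when $J^{(k-1)}$ is a subbundle. If $N$ is the smallest integer with $J^{(N)}=J^{(N+1)}$, the system is of type $(\mathrm{corank}\,J,\mathrm{corank}\,J^{(1)},\dots,\mathrm{corank}\,J^{(N)})$, where $\mathrm{corank}=\dim M-\mathrm{rank}$. "Of type $(\dots)$ at a point $m$" refers to the fibres at $m$: the kernels, their coranks and the stabilisation $J^{(N)}_m=J^{(N+1)}_m$ are taken at $m$. *)

theory Defs
  imports "HOL-Analysis.Analysis"
begin

section \<open>Smooth maps\<close>

text \<open>Only meant for open \<open>M\<close>: all iterated directional derivatives exist as Frechet derivatives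
  and are continuous.\<close>

fun higher_differentiable_on ::
  "'a::real_normed_vector set \<Rightarrow> ('a \<Rightarrow> 'b::real_normed_vector) \<Rightarrow> nat \<Rightarrow> bool" where
  "higher_differentiable_on M f 0 \<longleftrightarrow> continuous_on M f"
| "higher_differentiable_on M f (Suc k) \<longleftrightarrow>
     (\<forall>P\<in>M. f differentiable (at P)) \<and>
     (\<forall>v. higher_differentiable_on M (\<lambda>P. frechet_derivative f (at P) v) k)"

definition smooth_on :: "'a::real_normed_vector set \<Rightarrow> ('a \<Rightarrow> 'b::real_normed_vector) \<Rightarrow> bool" where
  "smooth_on M f \<longleftrightarrow> (\<forall>k. higher_differentiable_on M f k)"

section \<open>Exterior forms and exterior differential systems\<close>

text \<open>An element of the full exterior algebra of the dual space is encoded as one function on lists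
  of vectors: its restriction to lists of length \<open>k\<close> is its component of degree \<open>k\<close>.\<close>

definition alternating_form :: "('a::real_vector list \<Rightarrow> real) \<Rightarrow> bool" where
  "alternating_form \<phi> \<longleftrightarrow>
     (\<forall>us vs. linear (\<lambda>v. \<phi> (us @ v # vs))) \<and>
     (\<forall>us vs ws v. \<phi> (us @ v # vs @ v # ws) = 0)"

text \<open>Sum over all shuffles, without normalising factor, so that
  \<open>(\<phi> \<and> \<psi>)(u, v) = \<phi> u * \<psi> v - \<phi> v * \<psi> u\<close> in degree \<open>1 + 1\<close>. The set \<open>S\<close> collects the positions
  of the arguments of \<open>\<phi>\<close>.\<close>

definition wedge :: "('a list \<Rightarrow> real) \<Rightarrow> ('a list \<Rightarrow> real) \<Rightarrow> 'a list \<Rightarrow> real" where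
  "wedge \<phi> \<psi> vs =
     (\<Sum>S\<in>Pow {..<length vs}.
        (-1) ^ card {(i, j). i \<notin> S \<and> j \<in> S \<and> i < j} * \<phi> (nths vs S) * \<psi> (nths vs (- S)))"

definition interior_product :: "'a \<Rightarrow> ('a list \<Rightarrow> real) \<Rightarrow> 'a list \<Rightarrow> real" where
  "interior_product X \<phi> vs = \<phi> (X # vs)"

definition covector :: "('a::real_normed_vector \<Rightarrow>\<^sub>L real) \<Rightarrow> 'a list \<Rightarrow> real" where
  "covector \<theta> vs = (case vs of [v] \<Rightarrow> blinfun_apply \<theta> v | _ \<Rightarrow> 0)"

type_synonym 'a dform = "'a \<Rightarrow> 'a list \<Rightarrow> real"

definition differential_form :: "'a::real_normed_vector set \<Rightarrow> 'a dform \<Rightarrow> bool" where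
  "differential_form M \<omega> \<longleftrightarrow>
     (\<forall>P\<in>M. alternating_form (\<omega> P)) \<and> (\<forall>vs. smooth_on M (\<lambda>P. \<omega> P vs))"

definition one_form :: "('a::real_normed_vector \<Rightarrow> ('a \<Rightarrow>\<^sub>L real)) \<Rightarrow> 'a dform" where
  "one_form \<theta> P = covector (\<theta> P)"

text \<open>The invariant formula for the exterior derivative, evaluated on constant vector fields, whose
  Lie brackets vanish.\<close>

definition ext_deriv :: "'a::real_normed_vector dform \<Rightarrow> 'a dform" where
  "ext_deriv \<omega> P vs =
     (\<Sum>i<length vs. (-1) ^ i *
        frechet_derivative (\<lambda>R. \<omega> R (take i vs @ drop (Suc i) vs)) (at P) (vs ! i))"

definition pullback ::
  "('a::real_normed_vector \<Rightarrow> 'b::real_normed_vector) \<Rightarrow> 'b dform \<Rightarrow> 'a dform" where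
  "pullback f \<omega> P vs = \<omega> (f P) (map (frechet_derivative f (at P)) vs)"

text \<open>The two-sided ideal generated by \<open>G\<close> in the algebra of smooth forms on \<open>M\<close>. Forms are total
  functions, but only their values on \<open>M\<close> matter, hence the rule \<open>agree\<close>.\<close>

inductive_set alg_ideal :: "'a::real_normed_vector set \<Rightarrow> 'a dform set \<Rightarrow> 'a dform set"
  for M :: "'a set" and G :: "'a dform set" where
  zero: "(\<lambda>P vs. 0) \<in> alg_ideal M G"
| gen: "\<omega> \<in> G \<Longrightarrow> \<omega> \<in> alg_ideal M G"
| add: "\<omega> \<in> alg_ideal M G \<Longrightarrow> \<eta> \<in> alg_ideal M G \<Longrightarrow> (\<lambda>P vs. \<omega> P vs + \<eta> P vs) \<in> alg_ideal M G"
| wedge_left: "differential_form M \<beta> \<Longrightarrow> \<omega> \<in> alg_ideal M G \<Longrightarrow>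
    (\<lambda>P. wedge (\<beta> P) (\<omega> P)) \<in> alg_ideal M G"
| wedge_right: "differential_form M \<beta> \<Longrightarrow> \<omega> \<in> alg_ideal M G \<Longrightarrow>
    (\<lambda>P. wedge (\<omega> P) (\<beta> P)) \<in> alg_ideal M G"
| agree: "\<omega> \<in> alg_ideal M G \<Longrightarrow> (\<And>P. P \<in> M \<Longrightarrow> \<eta> P = \<omega> P) \<Longrightarrow> \<eta> \<in> alg_ideal M G"

definition diff_ideal :: "'a::real_normed_vector set \<Rightarrow> 'a dform set \<Rightarrow> 'a dform set" where
  "diff_ideal M G = alg_ideal M (G \<union> ext_deriv ` G)"

text \<open>The fibre at \<open>P\<close> of the Cauchy characteristic system: \<open>\<iota>\<^sub>X\<close> maps the ideal of values at \<open>P\<close> of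
  elements of \<open>\<I>\<close> into itself.\<close>

definition cauchy_char :: "'a::real_normed_vector dform set \<Rightarrow> 'a \<Rightarrow> 'a set" where
  "cauchy_char \<I> P =
     {X. \<forall>\<omega>\<in>\<I>. interior_product X (\<omega> P) \<in> (\<lambda>\<eta>. \<eta> P) ` \<I>}"

text \<open>\<open>\<pi> : M \<rightarrow> W\<close> is, in a chart \<open>W\<close> of the leaf space, the quotient map by the foliation tangent to
  \<open>E\<close>: a surjective submersion whose fibres are connected and tangent to \<open>E\<close>, i.e. are the leaves
  of \<open>E\<close> in \<open>M\<close>.\<close>

definition leaf_space_projection ::
  "'a::euclidean_space set \<Rightarrow> ('a \<Rightarrow> 'a set) \<Rightarrow> ('a \<Rightarrow> 'b::euclidean_space) \<Rightarrow> 'b set \<Rightarrow> bool" where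
  "leaf_space_projection M E \<pi> W \<longleftrightarrow>
     open M \<and> open W \<and> smooth_on M \<pi> \<and> \<pi> ` M = W \<and>
     (\<forall>P\<in>M. surj (frechet_derivative \<pi> (at P)) \<and>
             {X. frechet_derivative \<pi> (at P) X = 0} = E P) \<and>
     (\<forall>w\<in>W. connected {P \<in> M. \<pi> P = w})"

section \<open>Pfaffian systems and their derived type\<close>

text \<open>A field of subspaces of the cotangent spaces is a function \<open>J\<close>; only its germ at the points
  under consideration matters.\<close>

definition smooth_frame_on ::
  "'a::euclidean_space set \<Rightarrow> ('a \<Rightarrow> ('a \<Rightarrow>\<^sub>L real)) list \<Rightarrow> ('a \<Rightarrow> ('a \<Rightarrow>\<^sub>L real) set) \<Rightarrow> bool" where
  "smooth_frame_on M \<theta>s J \<longleftrightarrow>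
     (\<forall>\<theta>\<in>set \<theta>s. smooth_on M \<theta>) \<and>
     (\<forall>P\<in>M. distinct (map (\<lambda>\<theta>. \<theta> P) \<theta>s) \<and>
             independent (set (map (\<lambda>\<theta>. \<theta> P) \<theta>s)) \<and>
             J P = span (set (map (\<lambda>\<theta>. \<theta> P) \<theta>s)))"

definition subbundle_near :: "('a::euclidean_space \<Rightarrow> ('a \<Rightarrow>\<^sub>L real) set) \<Rightarrow> 'a \<Rightarrow> bool" where
  "subbundle_near J m \<longleftrightarrow> (\<exists>N \<theta>s. open N \<and> m \<in> N \<and> smooth_frame_on N \<theta>s J)"

text \<open>\<open>\<phi> mod A = 0\<close> in the second exterior power of the quotient of the dual space by \<open>A\<close>; that is,
  \<open>\<phi>\<close> is a sum of products of a covector in \<open>A\<close> with an arbitrary covector.\<close>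

definition two_form_zero_mod ::
  "('a::real_normed_vector \<Rightarrow>\<^sub>L real) set \<Rightarrow> ('a list \<Rightarrow> real) \<Rightarrow> bool" where
  "two_form_zero_mod A \<phi> \<longleftrightarrow>
     (\<exists>(n::nat) a b. (\<forall>i<n. a i \<in> A) \<and>
        \<phi> = (\<lambda>vs. \<Sum>i<n. wedge (covector (a i)) (covector (b i)) vs))"

text \<open>The fibrewise kernel of \<open>\<theta> \<mapsto> d\<theta> mod J\<close>. When \<open>J\<close> is a subbundle near \<open>m\<close>, the class of
  \<open>d\<theta>\<close> at \<open>m\<close> depends only on the value \<open>\<theta> m\<close>, so one local section through it suffices.\<close>

definition derived_system ::
  "('a::euclidean_space \<Rightarrow> ('a \<Rightarrow>\<^sub>L real) set) \<Rightarrow> 'a \<Rightarrow> ('a \<Rightarrow>\<^sub>L real) set" where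
  "derived_system J m =
     {\<theta> m |\<theta> N. open N \<and> m \<in> N \<and> smooth_on N \<theta> \<and> (\<forall>P\<in>N. \<theta> P \<in> J P) \<and>
        two_form_zero_mod (J m) (ext_deriv (one_form \<theta>) m)}"

definition corank_at :: "('a::euclidean_space \<Rightarrow> ('a \<Rightarrow>\<^sub>L real) set) \<Rightarrow> 'a \<Rightarrow> nat" where
  "corank_at J m = DIM('a) - dim (J m)"

definition derived_type_at ::
  "('a::euclidean_space \<Rightarrow> ('a \<Rightarrow>\<^sub>L real) set) \<Rightarrow> 'a \<Rightarrow> nat list \<Rightarrow> bool" where
  "derived_type_at J m ds \<longleftrightarrow>
     (\<exists>N. (\<forall>k\<le>N. subbundle_near ((derived_system ^^ k) J) m) \<and>
          (derived_system ^^ N) J m = (derived_system ^^ Suc N) J m \<and>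
          (\<forall>k<N. (derived_system ^^ k) J m \<noteq> (derived_system ^^ Suc k) J m) \<and>
          ds = map (\<lambda>k. corank_at ((derived_system ^^ k) J) m) [0..<Suc N])"

section \<open>The jet space\<close>

text \<open>Points of the coordinate domain of \<open>J\<^sup>1(2,1)\<close> are vectors \<open>P = (x, y, z, p, q)\<close>, with
  \<open>x = P $ 1, \<dots>, q = P $ 5\<close>.\<close>

type_synonym jet = "real ^ 5"

definition pd :: "5 \<Rightarrow> (jet \<Rightarrow> real) \<Rightarrow> jet \<Rightarrow> real" where
  "pd i f P = frechet_derivative f (at P) (axis i 1)"

lift_definition dcoord :: "'n::finite \<Rightarrow> (real ^ 'n) \<Rightarrow>\<^sub>L real" is "\<lambda>i v. v $ i"
  by (rule bounded_linear_vec_nth)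

definition contact_form :: "jet \<Rightarrow> (jet \<Rightarrow>\<^sub>L real)" where
  "contact_form P = dcoord 3 - (P $ 4) *\<^sub>R dcoord 1 - (P $ 5) *\<^sub>R dcoord 2"

definition second_form :: "(jet \<Rightarrow> real) \<Rightarrow> jet \<Rightarrow> (jet \<Rightarrow>\<^sub>L real)" where
  "second_form \<alpha> P = dcoord 4 - \<alpha> P *\<^sub>R dcoord 5"

definition jet_system :: "jet set \<Rightarrow> (jet \<Rightarrow> real) \<Rightarrow> jet dform set" where
  "jet_system V \<alpha> = diff_ideal V {one_form contact_form, one_form (second_form \<alpha>)}"

definition total_y :: "(jet \<Rightarrow> real) \<Rightarrow> jet \<Rightarrow> real" where
  "total_y \<alpha> P = pd 2 \<alpha> P + P $ 5 * pd 3 \<alpha> P"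

definition involutive_type_on :: "jet set \<Rightarrow> (jet \<Rightarrow> real) \<Rightarrow> bool" where
  "involutive_type_on U \<alpha> \<longleftrightarrow>
     (\<forall>P\<in>U. pd 1 \<alpha> P + P $ 4 * pd 3 \<alpha> P - \<alpha> P * total_y \<alpha> P = 0)"

definition generic_type_on :: "jet set \<Rightarrow> (jet \<Rightarrow> real) \<Rightarrow> bool" where
  "generic_type_on U \<alpha> \<longleftrightarrow> (\<forall>P\<in>U. 1 + P $ 1 * total_y \<alpha> P \<noteq> 0)"

definition star_condition :: "(jet \<Rightarrow> real) \<Rightarrow> jet \<Rightarrow> bool" where
  "star_condition \<alpha> P \<longleftrightarrow>
     pd 4 \<alpha> P * total_y \<alpha> P - \<alpha> P * pd 4 (total_y \<alpha>) P - pd 5 (total_y \<alpha>) P - pd 3 \<alpha> P = 0 \<and>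
     pd 2 (pd 2 \<alpha>) P + 2 * P $ 5 * pd 3 (pd 2 \<alpha>) P + (P $ 5)\<^sup>2 * pd 3 (pd 3 \<alpha>) P = 0"

text \<open>\<open>\<pi> : V \<rightarrow> W\<close> is the projection to the local leaf space of the Cauchy characteristics of the
  system \<open>\<I>\<close> on \<open>V\<close>, and the reduced system, generated by the frame \<open>\<theta>s\<close> of \<open>J\<close> on \<open>W\<close>, is
  characterised by the fact that its pullback generates \<open>\<I>\<close> algebraically. A choice for generic
  \<open>\<alpha>\<close> is \<open>\<pi> P = (y + \<alpha> x, z - p x - q y, p, q)\<close>, with \<open>J\<close> spanned by \<open>dx\<^sub>2 + x\<^sub>1 dx\<^sub>4\<close> and
  \<open>dx\<^sub>3 - a dx\<^sub>4\<close>, where \<open>\<alpha> = a \<circ> \<pi>\<close>.\<close>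

definition reduction ::
  "(jet \<Rightarrow> real) \<Rightarrow> jet set \<Rightarrow> (jet \<Rightarrow> real ^ 4) \<Rightarrow> (real ^ 4) set \<Rightarrow>
   (real ^ 4 \<Rightarrow> ((real ^ 4) \<Rightarrow>\<^sub>L real) set) \<Rightarrow> bool" where
  "reduction \<alpha> V \<pi> W J \<longleftrightarrow>
     leaf_space_projection V (cauchy_char (jet_system V \<alpha>)) \<pi> W \<and>
     (\<exists>\<theta>s. smooth_frame_on W \<theta>s J \<and>
        jet_system V \<alpha> = alg_ideal V (pullback \<pi> ` diff_ideal W (one_form ` set \<theta>s)))"

end

theory Submission
  imports Defs
begin

text \<open>
  Write \<open>\<omega>\<^sub>0 = dz - p dx - q dy\<close>, \<open>\<omega>\<^sub>1 = dp - \<alpha> dq\<close>, \<open>D = \<partial>\<^sub>y + q \<partial>\<^sub>z\<close> and \<open>T = D \<alpha>\<close>. Comparing the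
  parts of degree one of the two ideals shows that \<open>\<pi>\<close> pulls \<open>J\<close> back to the span of \<open>\<omega>\<^sub>0\<close> and \<open>\<omega>\<^sub>1\<close>,
  so \<open>J\<close> has rank \<open>2\<close> and everything can be computed on the jet space. Involutivity gives
  \<open>d\<omega>\<^sub>1 = - T d\<omega>\<^sub>0\<close> modulo \<open>\<omega>\<^sub>0, \<omega>\<^sub>1\<close>, with \<open>d\<omega>\<^sub>0\<close> nonzero there; hence the first derived system is
  the line bundle that pulls back to the span of \<open>\<omega>' = \<omega>\<^sub>1 + T \<omega>\<^sub>0\<close>. Differentiating the involutivity
  equation along \<open>D\<close> makes the \<open>dx \<and> \<omega>\<^sub>0\<close> term of \<open>d\<omega>'\<close> modulo \<open>\<omega>'\<close> vanish, and the coefficients of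
  \<open>(dy + \<alpha> dx) \<and> \<omega>\<^sub>0\<close> and \<open>dq \<and> \<omega>\<^sub>0\<close> that remain are, up to sign, the two left-hand sides of the star
  condition. So the second derived system at a point is the first one or zero according to whether
  the condition holds there. Smooth frames near a point of the leaf space come from evaluating
  exterior derivatives on vector fields that span the kernels, which needs no local section of \<open>\<pi>\<close>.
\<close>

section \<open>Smooth functions\<close>

text \<open>Since \<open>M\<close> is open, agreement on \<open>M\<close> is agreement near each of
  its points, so the derivatives agree there too; this feeds the induction.\<close>

lemma higher_differentiable_on_cong:
  assumes "open M" "\<And>P. P \<in> M \<Longrightarrow> f P = g P" "higher_differentiable_on M f k"
  shows "higher_differentiable_on M g k"
  using assms(2,3)
proof (induction k arbitrary: f g)
  case 0
  then show ?case using continuous_on_cong[of M M f g] by simp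
next
  case (Suc k)
  have d: "(g has_derivative frechet_derivative f (at P)) (at P)" if "P \<in> M" for P
    using has_derivative_transform_within_open[of f "frechet_derivative f (at P)" P UNIV M g]
      Suc.prems that \<open>open M\<close> frechet_derivative_works by auto
  have "higher_differentiable_on M (\<lambda>P. frechet_derivative g (at P) v) k" for v
    using Suc.IH[of "\<lambda>P. frechet_derivative f (at P) v" "\<lambda>P. frechet_derivative g (at P) v"]
      Suc.prems frechet_derivative_at[OF d] by auto
  then show ?case using d by (auto simp: differentiable_def)
qed

text \<open>At \<open>Suc k\<close> only differentiability and the derivatives are recorded;
  continuity, the case \<open>k = 0\<close>, follows from differentiability.\<close>

lemma higher_differentiable_on_Suc_imp:
  "higher_differentiable_on M f (Suc k) \<Longrightarrow> higher_differentiable_on M f k"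
proof (induction k arbitrary: f)
  case 0
  then show ?case
    by (auto intro!: differentiable_imp_continuous_on simp: differentiable_on_def
        differentiable_at_withinI)
qed auto

lemma higher_differentiable_on_has_derivative:
  "higher_differentiable_on M f (Suc k) \<Longrightarrow> P \<in> M \<Longrightarrow>
    (f has_derivative frechet_derivative f (at P)) (at P)"
  using frechet_derivative_works by auto

lemma higher_differentiable_on_frechet_derivative:
  "higher_differentiable_on M f (Suc k) \<Longrightarrow>
    higher_differentiable_on M (\<lambda>P. frechet_derivative f (at P) v) k"
  by simp

lemma higher_differentiable_on_const: "higher_differentiable_on M (\<lambda>P. c) k"
  by (induction k arbitrary: c) auto

lemma higher_differentiable_on_add:
  assumes "open M" "higher_differentiable_on M f k" "higher_differentiable_on M g k"
  shows "higher_differentiable_on M (\<lambda>P. f P + g P) k"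
  using assms(2,3)
proof (induction k arbitrary: f g)
  case 0
  then show ?case by (simp add: continuous_on_add)
next
  case (Suc k)
  note der = higher_differentiable_on_has_derivative[OF Suc.prems(1)]
    higher_differentiable_on_has_derivative[OF Suc.prems(2)]
  note d = has_derivative_add[OF der]
  have "higher_differentiable_on M (\<lambda>P. frechet_derivative (\<lambda>P. f P + g P) (at P) v) k" for v
    by (rule higher_differentiable_on_cong[OF \<open>open M\<close> _
          Suc.IH[OF Suc.prems[THEN higher_differentiable_on_frechet_derivative]]])
      (simp add: frechet_derivative_at[OF d, symmetric])
  then show ?case using d by (auto simp: differentiable_def)
qed

text \<open>Leibniz rule: each term pairs one factor with a derivative of the other, so the
  undifferentiated factor is lowered to order \<open>k\<close> before the induction hypothesis
  applies.\<close>

lemma (in bounded_bilinear) higher_differentiable_on: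
  assumes "open M" "higher_differentiable_on M f k" "higher_differentiable_on M g k"
  shows "higher_differentiable_on M (\<lambda>P. prod (f P) (g P)) k"
  using assms(2,3)
proof (induction k arbitrary: f g)
  case 0
  then show ?case by (simp add: continuous_on)
next
  case (Suc k)
  note d = FDERIV[OF higher_differentiable_on_has_derivative[OF Suc.prems(1)]
    higher_differentiable_on_has_derivative[OF Suc.prems(2)]]
  have "higher_differentiable_on M (\<lambda>P. frechet_derivative (\<lambda>P. prod (f P) (g P)) (at P) v) k" for v
    by (rule higher_differentiable_on_cong[OF \<open>open M\<close> _ higher_differentiable_on_add[OF \<open>open M\<close>
          Suc.IH[OF Suc.prems(1)[THEN higher_differentiable_on_Suc_imp]
            Suc.prems(2)[THEN higher_differentiable_on_frechet_derivative]]
          Suc.IH[OF Suc.prems(1)[THEN higher_differentiable_on_frechet_derivative]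
            Suc.prems(2)[THEN higher_differentiable_on_Suc_imp]]]])
      (simp add: frechet_derivative_at[OF d, symmetric])
  then show ?case using d by (auto simp: differentiable_def)
qed

section \<open>Calculus of smooth functions\<close>

lemma smooth_on_differentiable: "smooth_on M f \<Longrightarrow> P \<in> M \<Longrightarrow> f differentiable (at P)"
  unfolding smooth_on_def by (metis higher_differentiable_on.simps(2))

lemma smooth_on_has_derivative:
  "smooth_on M f \<Longrightarrow> P \<in> M \<Longrightarrow> (f has_derivative frechet_derivative f (at P)) (at P)"
  using smooth_on_differentiable frechet_derivative_works by blast

lemma smooth_on_continuous_on: "smooth_on M f \<Longrightarrow> continuous_on M f"
  unfolding smooth_on_def by (metis higher_differentiable_on.simps(1))

lemma smooth_on_frechet_derivative:
  "smooth_on M f \<Longrightarrow> smooth_on M (\<lambda>P. frechet_derivative f (at P) v)"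
  unfolding smooth_on_def by (metis higher_differentiable_on.simps(2))

lemma smooth_on_subset:
  assumes "smooth_on M f" "N \<subseteq> M" shows "smooth_on N f"
proof -
  have "higher_differentiable_on M f k \<Longrightarrow> higher_differentiable_on N f k" for k
  proof (induction k arbitrary: f)
    case 0
    then show ?case using \<open>N \<subseteq> M\<close> continuous_on_subset by auto
  next
    case (Suc k)
    then show ?case using \<open>N \<subseteq> M\<close> by auto
  qed
  then show ?thesis using assms(1) by (auto simp: smooth_on_def)
qed

lemma smooth_on_const: "smooth_on M (\<lambda>P. c)"
  by (simp add: smooth_on_def higher_differentiable_on_const)

lemma smooth_on_add:
  "open M \<Longrightarrow> smooth_on M f \<Longrightarrow> smooth_on M g \<Longrightarrow> smooth_on M (\<lambda>P. f P + g P)"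
  by (simp add: smooth_on_def higher_differentiable_on_add)

lemma (in bounded_bilinear) smooth_on:
  "open M \<Longrightarrow> smooth_on M f \<Longrightarrow> smooth_on M g \<Longrightarrow> smooth_on M (\<lambda>P. prod (f P) (g P))"
  by (simp add: smooth_on_def higher_differentiable_on)

lemmas smooth_on_mult = bounded_bilinear.smooth_on[OF bounded_bilinear_mult]
lemmas smooth_on_scaleR = bounded_bilinear.smooth_on[OF bounded_bilinear_scaleR]
lemmas smooth_on_inner = bounded_bilinear.smooth_on[OF bounded_bilinear_inner]
lemmas smooth_on_blinfun_apply = bounded_bilinear.smooth_on[OF bounded_bilinear_blinfun_apply]

lemma smooth_on_minus:
  assumes "open M" "smooth_on M f" shows "smooth_on M (\<lambda>P. - f P)"
  using smooth_on_scaleR[OF assms(1) smooth_on_const[of M "-1"] assms(2)] by simp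

lemma smooth_on_diff:
  assumes "open M" "smooth_on M f" "smooth_on M g" shows "smooth_on M (\<lambda>P. f P - g P)"
  using smooth_on_add[OF assms(1,2) smooth_on_minus[OF assms(1,3)]] by simp

lemma smooth_on_sum:
  assumes "open M" "finite I" "\<And>i. i \<in> I \<Longrightarrow> smooth_on M (f i)"
  shows "smooth_on M (\<lambda>P. \<Sum>i\<in>I. f i P)"
  using assms(2,3)
  by (induction I rule: finite_induct) (simp_all add: smooth_on_const smooth_on_add \<open>open M\<close>)

section \<open>Symmetry of second derivatives\<close>

text \<open>The mean value theorem is applied twice: along \<open>u\<close> to the difference of
  \<open>f\<close> on two parallel segments, then along \<open>v\<close> to the derivative in
  direction \<open>u\<close>. The bound on \<open>s\<close> keeps all points involved in the
  ball.\<close>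

lemma mixed_difference_mean_value:
  fixes f :: "'a::real_normed_vector \<Rightarrow> real"
  assumes f: "smooth_on (ball x e) f" and s: "0 < s" "s * (norm u + norm v) < e"
  shows "\<exists>y. dist x y \<le> s * (norm u + norm v) \<and>
    f (x + s *\<^sub>R u + s *\<^sub>R v) - f (x + s *\<^sub>R u) - f (x + s *\<^sub>R v) + f x =
    s * s * frechet_derivative (\<lambda>y. frechet_derivative f (at y) u) (at y) v"
proof -
  let ?Du = "\<lambda>y. frechet_derivative f (at y) u"
  have le: "norm (t *\<^sub>R u + r *\<^sub>R v) \<le> s * (norm u + norm v)"
    if "0 \<le> t" "t \<le> s" "0 \<le> r" "r \<le> s" for t r
  proof -
    have "norm (t *\<^sub>R u + r *\<^sub>R v) \<le> t * norm u + r * norm v"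
      using norm_triangle_ineq[of "t *\<^sub>R u" "r *\<^sub>R v"] that by simp
    also have "\<dots> \<le> s * norm u + s * norm v"
      using that by (intro add_mono mult_right_mono) auto
    finally show ?thesis by (simp add: distrib_left)
  qed
  have b: "x + t *\<^sub>R u + r *\<^sub>R v \<in> ball x e"
    if "0 \<le> t" "t \<le> s" "0 \<le> r" "r \<le> s" for t r
    using le_less_trans[OF le[OF that] s(2)]
    by (simp add: dist_norm add.assoc norm_minus_commute add.commute)
  have line: "((\<lambda>t. g (y + t *\<^sub>R w)) has_real_derivative frechet_derivative g (at (y + t *\<^sub>R w)) w) (at t)"
    if "smooth_on (ball x e) g" "y + t *\<^sub>R w \<in> ball x e" for g :: "'a \<Rightarrow> real" and y w t
  proof -
    have "((\<lambda>t. g (y + t *\<^sub>R w)) has_derivative (\<lambda>h. frechet_derivative g (at (y + t *\<^sub>R w)) (h *\<^sub>R w))) (at t)"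
      by (rule has_derivative_compose[of "\<lambda>t. y + t *\<^sub>R w" "\<lambda>h. h *\<^sub>R w", OF _
            smooth_on_has_derivative[OF that]]) (auto intro!: derivative_eq_intros)
    moreover have "(\<lambda>h. frechet_derivative g (at (y + t *\<^sub>R w)) (h *\<^sub>R w)) =
        (*) (frechet_derivative g (at (y + t *\<^sub>R w)) w)"
      using linear_cmul[OF linear_frechet_derivative[OF smooth_on_differentiable[OF that]]]
      by (simp add: fun_eq_iff)
    ultimately show ?thesis by (simp add: has_field_derivative_def)
  qed
  have "((\<lambda>t. f (x + s *\<^sub>R v + t *\<^sub>R u) - f (x + t *\<^sub>R u)) has_real_derivative
      ?Du (x + s *\<^sub>R v + t *\<^sub>R u) - ?Du (x + t *\<^sub>R u)) (at t)" if "0 \<le> t" "t \<le> s" for t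
    using b[of t s] b[of t 0] that s(1) by (intro DERIV_diff line f) (auto simp: add_ac)
  from MVT2[OF s(1) this] obtain z where z: "0 < z" "z < s"
    "(f (x + s *\<^sub>R v + s *\<^sub>R u) - f (x + s *\<^sub>R u)) - (f (x + s *\<^sub>R v + 0 *\<^sub>R u) - f (x + 0 *\<^sub>R u)) =
      (s - 0) * (?Du (x + s *\<^sub>R v + z *\<^sub>R u) - ?Du (x + z *\<^sub>R u))"
    by blast
  have "((\<lambda>t. ?Du (x + z *\<^sub>R u + t *\<^sub>R v)) has_real_derivative
      frechet_derivative ?Du (at (x + z *\<^sub>R u + t *\<^sub>R v)) v) (at t)" if "0 \<le> t" "t \<le> s" for t
    using b[of z t] that z by (intro line smooth_on_frechet_derivative f) auto
  from MVT2[OF s(1) this] obtain r where r: "0 < r" "r < s"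
    "?Du (x + z *\<^sub>R u + s *\<^sub>R v) - ?Du (x + z *\<^sub>R u + 0 *\<^sub>R v) =
      (s - 0) * frechet_derivative ?Du (at (x + z *\<^sub>R u + r *\<^sub>R v)) v"
    by blast
  show ?thesis
    using z(3) r(3) le[of z r] z(1,2) r(1,2)
    by (intro exI[of _ "x + z *\<^sub>R u + r *\<^sub>R v"]) (auto simp: dist_norm algebra_simps norm_minus_commute)
qed

text \<open>The mixed difference is symmetric in \<open>u\<close> and \<open>v\<close>, so the two
  second derivatives take a common value at points arbitrarily close to \<open>x\<close>. Half of a
  supposed gap at \<open>x\<close> serves as the tolerance that continuity then contradicts.\<close>

lemma symmetric_second_derivative_real:
  fixes f :: "'a::real_normed_vector \<Rightarrow> real"
  assumes "open M" "x \<in> M" and f: "smooth_on M f"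
  shows "frechet_derivative (\<lambda>y. frechet_derivative f (at y) u) (at x) v =
    frechet_derivative (\<lambda>y. frechet_derivative f (at y) v) (at x) u"
proof (rule ccontr)
  let ?F = "\<lambda>u v y. frechet_derivative (\<lambda>y. frechet_derivative f (at y) u) (at y) v"
  define d where "d = \<bar>?F u v x - ?F v u x\<bar> / 2"
  assume "\<not> ?thesis"
  then have d: "d > 0" by (simp add: d_def)
  obtain e where e: "e > 0" "ball x e \<subseteq> M" using assms openE by blast
  have c: "continuous (at x) (?F a b)" for a b
    using smooth_on_continuous_on[OF smooth_on_frechet_derivative[OF smooth_on_frechet_derivative[OF f]]]
      assms continuous_on_eq_continuous_at by blast
  obtain e1 where e1: "e1 > 0" "\<And>y. dist x y < e1 \<Longrightarrow> dist (?F u v y) (?F u v x) < d"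
    using c[of u v] d unfolding continuous_at_eps_delta by (metis dist_commute)
  obtain e2 where e2: "e2 > 0" "\<And>y. dist x y < e2 \<Longrightarrow> dist (?F v u y) (?F v u x) < d"
    using c[of v u] d unfolding continuous_at_eps_delta by (metis dist_commute)
  define m where "m = min e (min e1 e2)"
  \<comment> \<open>The summand 1 keeps the denominator positive when both vectors are zero and
    makes \<open>s * (norm u + norm v)\<close> strictly smaller than \<open>m\<close>.\<close>
  define s where "s = m / (norm u + norm v + 1)"
  have m: "m > 0" using e e1 e2 by (simp add: m_def)
  have pos: "norm u + norm v + 1 > 0" by (simp add: add_nonneg_pos)
  have s: "s > 0" using m pos by (simp add: s_def)
  have sm: "s * (norm u + norm v) < m"
  proof -
    have "s * (norm u + norm v + 1) = m" using pos by (simp add: s_def)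
    then show ?thesis using s by (simp add: distrib_left)
  qed
  have fb: "smooth_on (ball x e) f" using smooth_on_subset[OF f e(2)] .
  obtain y where y: "dist x y \<le> s * (norm u + norm v)"
    "f (x + s *\<^sub>R u + s *\<^sub>R v) - f (x + s *\<^sub>R u) - f (x + s *\<^sub>R v) + f x = s * s * ?F u v y"
    using mixed_difference_mean_value[OF fb s, of u v] sm by (auto simp: m_def)
  obtain z where z: "dist x z \<le> s * (norm v + norm u)"
    "f (x + s *\<^sub>R v + s *\<^sub>R u) - f (x + s *\<^sub>R v) - f (x + s *\<^sub>R u) + f x = s * s * ?F v u z"
    using mixed_difference_mean_value[OF fb s, of v u] sm by (auto simp: m_def add.commute)
  have "s * s * ?F u v y = s * s * ?F v u z"
    using y(2) z(2) by (simp add: algebra_simps)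
  then have eq: "?F u v y = ?F v u z" using s by simp
  have "dist (?F u v y) (?F u v x) < d" using y(1) sm by (intro e1(2)) (auto simp: m_def)
  moreover have "dist (?F v u z) (?F v u x) < d" using z(1) sm by (intro e2(2)) (auto simp: m_def add.commute)
  ultimately show False
    using eq dist_triangle_half_r[of "?F u v y" "?F u v x" "\<bar>?F u v x - ?F v u x\<bar>" "?F v u x"]
    by (simp add: d_def dist_real_def)
qed

text \<open>Pairing with a basis vector commutes with differentiation, so the real case applies to
  each component.\<close>

lemma symmetric_second_derivative:
  fixes f :: "'a::real_normed_vector \<Rightarrow> 'b::euclidean_space"
  assumes "open M" "x \<in> M" and f: "smooth_on M f"
  shows "frechet_derivative (\<lambda>y. frechet_derivative f (at y) u) (at x) v =
    frechet_derivative (\<lambda>y. frechet_derivative f (at y) v) (at x) u"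
proof (rule euclidean_eqI)
  fix b :: 'b assume "b \<in> Basis"
  have in1: "frechet_derivative (\<lambda>y. g y \<bullet> b) (at y) = (\<lambda>u. frechet_derivative g (at y) u \<bullet> b)"
    if "smooth_on M g" "y \<in> M" for g :: "'a \<Rightarrow> 'b" and y
    using that by (intro frechet_derivative_at[symmetric] bounded_linear.has_derivative[OF bounded_linear_inner_left]
        smooth_on_has_derivative)
  have fb: "smooth_on M (\<lambda>y. f y \<bullet> b)" by (intro smooth_on_inner smooth_on_const f assms)
  have in2: "frechet_derivative (\<lambda>y. frechet_derivative (\<lambda>y. f y \<bullet> b) (at y) u) (at x) v =
      frechet_derivative (\<lambda>y. frechet_derivative f (at y) u) (at x) v \<bullet> b" for u v
    using in1[OF smooth_on_frechet_derivative[OF f] \<open>x \<in> M\<close>, of u] in1[OF f]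
      frechet_derivative_transform_within_open[OF smooth_on_differentiable[OF smooth_on_frechet_derivative[OF fb]
         \<open>x \<in> M\<close>] \<open>open M\<close> \<open>x \<in> M\<close>, of u "\<lambda>y. frechet_derivative f (at y) u \<bullet> b"]
    by auto
  show "frechet_derivative (\<lambda>y. frechet_derivative f (at y) u) (at x) v \<bullet> b =
      frechet_derivative (\<lambda>y. frechet_derivative f (at y) v) (at x) u \<bullet> b"
    using symmetric_second_derivative_real[OF assms(1,2) fb, of u v] in2 by simp
qed

section \<open>Two-forms modulo a subspace of covectors\<close>

text \<open>The annihilator of \<open>A\<close>. Evaluating forms on it replaces computing in the
  quotient by \<open>A\<close>.\<close>

definition common_kernel :: "('a::real_normed_vector \<Rightarrow>\<^sub>L real) set \<Rightarrow> 'a set" where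
  "common_kernel A = {v. \<forall>\<theta>\<in>A. blinfun_apply \<theta> v = 0}"

lemma common_kernel_span: "common_kernel (span A) = common_kernel A"
proof -
  have "blinfun_apply \<theta> v = 0" if "\<theta> \<in> span A" "v \<in> common_kernel A" for \<theta> v
    using that(1)
    by (induction rule: span_induct_alt)
      (use that(2) in \<open>auto simp: common_kernel_def blinfun.add_left blinfun.scaleR_left\<close>)
  then show ?thesis by (auto simp: common_kernel_def span_base)
qed

text \<open>Drives the inductions over generators: a new covector either vanishes on the old
  annihilator or is normalised by some \<open>u\<close> in it, and then every old vector can be
  projected along \<open>u\<close>.\<close>

lemma common_kernel_insert_cases:
  obtains "common_kernel (insert \<theta> B) = common_kernel B"
  | u where "u \<in> common_kernel B" "blinfun_apply \<theta> u = 1"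
      "\<forall>v\<in>common_kernel B. v - blinfun_apply \<theta> v *\<^sub>R u \<in> common_kernel (insert \<theta> B)"
proof (cases "\<exists>u\<in>common_kernel B. blinfun_apply \<theta> u \<noteq> 0")
  case True
  then obtain u where u: "u \<in> common_kernel B" "blinfun_apply \<theta> u \<noteq> 0" by auto
  show ?thesis
    by (rule that(2)[of "(1 / blinfun_apply \<theta> u) *\<^sub>R u"])
      (use u in \<open>auto simp: common_kernel_def blinfun.scaleR_right blinfun.diff_right\<close>)
next
  case False
  then show ?thesis by (intro that(1)) (auto simp: common_kernel_def)
qed

text \<open>Double annihilator of a finitely generated space. Subtracting
  \<open>blinfun_apply \<mu> u\<close> times \<theta> makes the remainder vanish on the larger
  annihilator \<open>common_kernel B\<close>.\<close>

lemma in_span_if_vanishes_on_common_kernel: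
  assumes "finite B" "\<And>v. v \<in> common_kernel B \<Longrightarrow> blinfun_apply \<mu> v = 0"
  shows "\<mu> \<in> span B"
  using assms
proof (induction B arbitrary: \<mu> rule: finite_induct)
  case empty
  then have "\<mu> = 0" by (auto simp: common_kernel_def intro: blinfun_eqI)
  then show ?case by simp
next
  case (insert \<theta> B)
  consider "common_kernel (insert \<theta> B) = common_kernel B"
  | u where "u \<in> common_kernel B" "blinfun_apply \<theta> u = 1"
      "\<forall>v\<in>common_kernel B. v - blinfun_apply \<theta> v *\<^sub>R u \<in> common_kernel (insert \<theta> B)"
    by (rule common_kernel_insert_cases[of \<theta> B]) blast+
  then show ?case
  proof cases
    case 1
    then have "\<mu> \<in> span B" using insert by auto
    then show ?thesis using span_mono[of B "insert \<theta> B"] by auto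
  next
    case (2 u)
    have "\<mu> - blinfun_apply \<mu> u *\<^sub>R \<theta> \<in> span B"
    proof (rule insert.IH)
      fix v assume "v \<in> common_kernel B"
      from insert.prems[OF bspec[OF 2(3) this]]
      show "blinfun_apply (\<mu> - blinfun_apply \<mu> u *\<^sub>R \<theta>) v = 0"
        by (simp add: blinfun.diff_left blinfun.diff_right blinfun.scaleR_left blinfun.scaleR_right)
    qed
    then show ?thesis by (auto simp: span_insert)
  qed
qed

section \<open>Wedge products of covectors and two-forms modulo a span\<close>

lemma covector_length: "length vs \<noteq> 1 \<Longrightarrow> covector \<theta> vs = 0"
  by (auto simp: covector_def split: list.splits)

lemma wedge_Nil: "wedge \<phi> \<psi> [] = \<phi> [] * \<psi> []"
  by (simp add: wedge_def)

lemma no_inversion: "{(i::nat, j). 0 < i \<and> j = 0 \<and> i < j} = {}"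
  by auto

lemma wedge_single: "wedge \<phi> \<psi> [v] = \<phi> [v] * \<psi> [] + \<phi> [] * \<psi> [v]"
  by (simp add: wedge_def no_inversion lessThan_Suc Pow_insert)

lemma wedge_pair_covector:
  "wedge (covector a) (covector b) [u, v] =
    blinfun_apply a u * blinfun_apply b v - blinfun_apply a v * blinfun_apply b u"
proof -
  have "Pow {..<2::nat} = {{}, {0}, {Suc 0}, {0, Suc 0}}"
    by (auto simp: numeral_2_eq_2 lessThan_Suc Pow_insert)
  moreover have "{(i, j). i \<noteq> Suc 0 \<and> j = Suc 0 \<and> i < j} = {(0, Suc 0)}" by auto
  ultimately show ?thesis
    by (simp add: wedge_def numeral_2_eq_2 nths_Cons covector_def no_inversion)
qed

text \<open>A covector lives on lists of length one, and a set of positions and its complement split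
  \<open>vs\<close> into two sublists, so a nonzero term forces length two.\<close>

lemma wedge_covector_length:
  assumes "length vs \<noteq> 2"
  shows "wedge (covector a) (covector b) vs = 0"
proof -
  have "length (nths vs S) \<noteq> 1 \<or> length (nths vs (- S)) \<noteq> 1" for S
  proof -
    have "length (nths vs S) + length (nths vs (- S)) =
        card ({i. i < length vs \<and> i \<in> S} \<union> {i. i < length vs \<and> i \<in> - S})"
      unfolding length_nths by (subst card_Un_disjoint) auto
    also have "{i. i < length vs \<and> i \<in> S} \<union> {i. i < length vs \<and> i \<in> - S} = {..<length vs}" by auto
    finally show ?thesis using assms by auto
  qed
  then show ?thesis
    unfolding wedge_def by (intro sum.neutral ballI) (use covector_length in fastforce)
qed

lemma two_form_zero_mod_mono: "two_form_zero_mod A \<phi> \<Longrightarrow> A \<subseteq> B \<Longrightarrow> two_form_zero_mod B \<phi>"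
  unfolding two_form_zero_mod_def by blast

lemma two_form_zero_mod_add_wedge:
  assumes "two_form_zero_mod A \<phi>" "a \<in> A"
  shows "two_form_zero_mod A (\<lambda>vs. \<phi> vs + wedge (covector a) (covector b) vs)"
proof -
  obtain n :: nat and f g where fg: "\<forall>i<n. f i \<in> A"
    "\<phi> = (\<lambda>vs. \<Sum>i<n. wedge (covector (f i)) (covector (g i)) vs)"
    using assms(1) unfolding two_form_zero_mod_def by blast
  show ?thesis
    unfolding two_form_zero_mod_def fg(2)
    by (intro exI[of _ "Suc n"] exI[of _ "f(n := a)"] exI[of _ "g(n := b)"])
      (use fg(1) assms(2) in \<open>simp add: less_Suc_eq\<close>)
qed

lemma two_form_zero_mod_vanishes:
  assumes "two_form_zero_mod A \<phi>" "u \<in> common_kernel A" "v \<in> common_kernel A"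
  shows "\<phi> [u, v] = 0"
  using assms unfolding two_form_zero_mod_def common_kernel_def
  by (auto simp: wedge_pair_covector)

text \<open>The assumptions make \<phi> an alternating form of degree two that vanishes on the
  annihilator. In the induction a product with the new covector is split off so that the rest
  vanishes on the larger annihilator of \<open>B\<close>.\<close>

lemma two_form_zero_mod_spanI:
  fixes \<phi> :: "'a::euclidean_space list \<Rightarrow> real"
  assumes "finite B"
    and "\<And>vs. length vs \<noteq> 2 \<Longrightarrow> \<phi> vs = 0"
    and "\<And>u. linear (\<lambda>v. \<phi> [u, v])" and "\<And>u v. \<phi> [v, u] = - \<phi> [u, v]"
    and "\<And>u v. u \<in> common_kernel B \<Longrightarrow> v \<in> common_kernel B \<Longrightarrow> \<phi> [u, v] = 0"
  shows "two_form_zero_mod (span B) \<phi>"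
  using assms
proof (induction B arbitrary: \<phi> rule: finite_induct)
  case empty
  have "\<phi> vs = 0" for vs
  proof (cases "length vs = 2")
    case True
    then obtain u v where "vs = [u, v]" by (auto simp: numeral_2_eq_2 length_Suc_conv)
    then show ?thesis using empty.prems(4) by (simp add: common_kernel_def)
  qed (use empty.prems(1) in auto)
  then show ?case
    unfolding two_form_zero_mod_def by (intro exI[of _ 0]) auto
next
  case (insert \<theta> B)
  note lin = insert.prems(2) and anti = insert.prems(3)
  consider "common_kernel (insert \<theta> B) = common_kernel B"
  | u where "u \<in> common_kernel B" "blinfun_apply \<theta> u = 1"
      "\<forall>v\<in>common_kernel B. v - blinfun_apply \<theta> v *\<^sub>R u \<in> common_kernel (insert \<theta> B)"
    by (rule common_kernel_insert_cases[of \<theta> B]) blast+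
  then show ?case
  proof cases
    case 1
    then have "two_form_zero_mod (span B) \<phi>" using insert by metis
    then show ?thesis by (rule two_form_zero_mod_mono) (simp add: span_mono subset_insertI)
  next
    case (2 u)
    \<comment> \<open>Contraction of \<phi> with \<open>u\<close>. As \<theta> takes the value 1 on
      \<open>u\<close>, removing the product of \<theta> and \<open>b\<close> makes the contraction
      with \<open>u\<close> vanish.\<close>
    define b where "b = Blinfun (\<lambda>v. \<phi> [u, v])"
    have b: "blinfun_apply b v = \<phi> [u, v]" for v
      using lin by (simp add: b_def bounded_linear_Blinfun_apply linear_conv_bounded_linear)
    define \<psi> where "\<psi> vs = \<phi> vs + wedge (covector \<theta>) (covector (- b)) vs" for vs
    have \<psi>2: "\<psi> [v, w] = \<phi> [v, w] - blinfun_apply \<theta> v * \<phi> [u, w] + blinfun_apply \<theta> w * \<phi> [u, v]" for v w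
      by (simp add: \<psi>_def wedge_pair_covector b blinfun.minus_left)
    have "two_form_zero_mod (span B) \<psi>"
    proof (rule insert.IH)
      fix vs :: "'a list" assume "length vs \<noteq> 2"
      then show "\<psi> vs = 0" using insert.prems(1) by (simp add: \<psi>_def wedge_covector_length)
    next
      fix v show "linear (\<lambda>w. \<psi> [v, w])"
        unfolding \<psi>2 using lin
        by (auto simp: linear_iff blinfun.add_right blinfun.scaleR_right algebra_simps)
    next
      fix v w show "\<psi> [w, v] = - \<psi> [v, w]" using anti[of v w] by (simp add: \<psi>2)
    next
      fix v w assume vw: "v \<in> common_kernel B" "w \<in> common_kernel B"
      have uu: "\<phi> [u, u] = 0" using anti[of u u] by simp
      have lin': "\<phi> [x, y - c *\<^sub>R z] = \<phi> [x, y] - c * \<phi> [x, z]" for x y c z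
        by (simp add: linear_diff[OF lin] linear_cmul[OF lin])
      have "\<phi> [v - c *\<^sub>R u, x] = \<phi> [v, x] - c * \<phi> [u, x]" for c x
        using lin'[of x v c u] anti[of x "v - c *\<^sub>R u"] anti[of x v] anti[of x u] by simp
      \<comment> \<open>The projections of \<open>v\<close> and \<open>w\<close> along
        \<open>u\<close> lie in the smaller annihilator; expanding \<phi> on them gives exactly
        \<open>\<psi> [v, w]\<close>.\<close>
      with lin' insert.prems(4)[OF bspec[OF 2(3) vw(1)] bspec[OF 2(3) vw(2)]]
      show "\<psi> [v, w] = 0" using uu anti[of u v] by (simp add: \<psi>2)
    qed
    then have "two_form_zero_mod (span (insert \<theta> B)) \<psi>"
      by (rule two_form_zero_mod_mono) (simp add: span_mono subset_insertI)
    from two_form_zero_mod_add_wedge[OF this, of \<theta> b]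
    have "two_form_zero_mod (span (insert \<theta> B)) (\<lambda>vs. \<psi> vs + wedge (covector \<theta>) (covector b) vs)"
      by (simp add: span_base)
    moreover have "\<psi> vs + wedge (covector \<theta>) (covector b) vs = \<phi> vs" for vs
    proof (cases "length vs = 2")
      case True
      then obtain v w where "vs = [v, w]" by (auto simp: numeral_2_eq_2 length_Suc_conv)
      then show ?thesis by (simp add: \<psi>2 wedge_pair_covector b)
    qed (use insert.prems(1) in \<open>simp add: \<psi>_def wedge_covector_length\<close>)
    ultimately show ?thesis by simp
  qed
qed

section \<open>Exterior derivatives of one-forms\<close>

text \<open>The value of d\<theta> on the constant fields \<open>u\<close> and \<open>v\<close>,
  freed from the encoding of forms by lists.\<close>

definition ext_deriv_pair ::
  "('a::real_normed_vector \<Rightarrow> ('a \<Rightarrow>\<^sub>L real)) \<Rightarrow> 'a \<Rightarrow> 'a \<Rightarrow> 'a \<Rightarrow> real" where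
  "ext_deriv_pair \<theta> m u v =
     blinfun_apply (frechet_derivative \<theta> (at m) u) v - blinfun_apply (frechet_derivative \<theta> (at m) v) u"

lemma frechet_derivative_blinfun_apply:
  assumes "\<theta> differentiable (at m)"
  shows "frechet_derivative (\<lambda>P. blinfun_apply (\<theta> P) v) (at m) u =
    blinfun_apply (frechet_derivative \<theta> (at m) u) v"
proof -
  have "((\<lambda>P. blinfun_apply (\<theta> P) v) has_derivative
      (\<lambda>u. blinfun_apply (frechet_derivative \<theta> (at m) u) v)) (at m)"
    using assms[unfolded frechet_derivative_works]
    by (rule bounded_linear.has_derivative[OF blinfun.bounded_linear_left])
  from frechet_derivative_at[OF this] show ?thesis by metis
qed

lemma ext_deriv_one_form_pair:
  assumes "\<theta> differentiable (at m)"
  shows "ext_deriv (one_form \<theta>) m [u, v] = ext_deriv_pair \<theta> m u v"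
  by (simp add: ext_deriv_def one_form_def covector_def ext_deriv_pair_def numeral_2_eq_2
      frechet_derivative_blinfun_apply[OF assms])

lemma ext_deriv_one_form_length:
  assumes "length vs \<noteq> 2"
  shows "ext_deriv (one_form \<theta>) m vs = 0"
proof -
  have "(\<lambda>R. one_form \<theta> R (take i vs @ drop (Suc i) vs)) = (\<lambda>R. 0)" if "i < length vs" for i
    unfolding one_form_def using assms that by (intro ext covector_length) auto
  then show ?thesis by (auto simp: ext_deriv_def intro!: sum.neutral)
qed

text \<open>Turns reduction modulo \<open>A\<close> into an evaluation test on the annihilator; all
  derived systems below are computed in this form.\<close>

lemma two_form_zero_mod_ext_deriv_iff:
  fixes \<theta> :: "'a::euclidean_space \<Rightarrow> ('a \<Rightarrow>\<^sub>L real)"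
  assumes "finite B" "A = span B" "\<theta> differentiable (at m)"
  shows "two_form_zero_mod A (ext_deriv (one_form \<theta>) m) \<longleftrightarrow>
    (\<forall>u\<in>common_kernel A. \<forall>v\<in>common_kernel A. ext_deriv_pair \<theta> m u v = 0)"
proof
  assume "two_form_zero_mod A (ext_deriv (one_form \<theta>) m)"
  from two_form_zero_mod_vanishes[OF this]
  show "\<forall>u\<in>common_kernel A. \<forall>v\<in>common_kernel A. ext_deriv_pair \<theta> m u v = 0"
    by (simp add: ext_deriv_one_form_pair assms)
next
  assume v: "\<forall>u\<in>common_kernel A. \<forall>v\<in>common_kernel A. ext_deriv_pair \<theta> m u v = 0"
  have lin: "linear (\<lambda>v. ext_deriv_pair \<theta> m u v)" for u
    using linear_frechet_derivative[OF assms(3)]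
    by (simp add: linear_iff ext_deriv_pair_def blinfun.add_left blinfun.add_right
        blinfun.scaleR_left blinfun.scaleR_right algebra_simps)
  have anti: "ext_deriv_pair \<theta> m v u = - ext_deriv_pair \<theta> m u v" for u v
    by (simp add: ext_deriv_pair_def)
  show "two_form_zero_mod A (ext_deriv (one_form \<theta>) m)"
    unfolding assms(2)
  proof (rule two_form_zero_mod_spanI[OF assms(1) ext_deriv_one_form_length])
    show "ext_deriv (one_form \<theta>) m [v, u] = - ext_deriv (one_form \<theta>) m [u, v]" for u v
      unfolding ext_deriv_one_form_pair[OF assms(3)] by (rule anti)
    show "linear (\<lambda>v. ext_deriv (one_form \<theta>) m [u, v])" for u
      unfolding ext_deriv_one_form_pair[OF assms(3)] by (rule lin)
    show "ext_deriv (one_form \<theta>) m [u, v] = 0"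
      if "u \<in> common_kernel B" "v \<in> common_kernel B" for u v
      using v that unfolding ext_deriv_one_form_pair[OF assms(3)] assms(2) common_kernel_span by blast
  qed
qed

section \<open>Parts of degree zero and one of an ideal\<close>

text \<open>In degrees zero and one a wedge product involves only the parts of its factors in these
  degrees, so vanishing at \<open>P\<close> survives every rule of the ideal.\<close>

lemma alg_ideal_low_degree:
  assumes "\<omega> \<in> alg_ideal M G" "P \<in> M"
    and "\<And>\<gamma>. \<gamma> \<in> G \<Longrightarrow> \<gamma> P [] = 0 \<and> (\<forall>v\<in>K. \<gamma> P [v] = 0)"
  shows "\<omega> P [] = 0 \<and> (\<forall>v\<in>K. \<omega> P [v] = 0)"
  using assms(1)
  by induction (use assms(2,3) in \<open>auto simp: wedge_Nil wedge_single\<close>)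

text \<open>Exterior derivatives of one-forms live in degree two, so in degree one only the
  one-forms themselves count.\<close>

lemma diff_ideal_one_forms_low_degree:
  assumes "\<omega> \<in> diff_ideal M (one_form ` \<Theta>)" "P \<in> M"
  shows "\<omega> P [] = 0 \<and> (\<forall>v\<in>common_kernel ((\<lambda>\<theta>. \<theta> P) ` \<Theta>). \<omega> P [v] = 0)"
  using assms(1) unfolding diff_ideal_def
  by (rule alg_ideal_low_degree[OF _ assms(2)])
    (auto simp: ext_deriv_one_form_length one_form_def covector_def common_kernel_def)

section \<open>Sections and their pullbacks\<close>

lemma exhaust_5: fixes i :: 5 shows "i = 1 \<or> i = 2 \<or> i = 3 \<or> i = 4 \<or> i = 5"
proof (induct i)
  case (of_int z)
  then have "0 \<le> z" and "z < 5" by simp_all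
  then have "z = 0 \<or> z = 1 \<or> z = 2 \<or> z = 3 \<or> z = 4" by arith
  then show ?case by auto
qed

lemma UNIV_5: "UNIV = {1, 2, 3, 4, 5::5}"
  using exhaust_5 by auto

lemma sum_5: "sum f (UNIV::5 set) = f 1 + f 2 + f 3 + f 4 + f 5"
  unfolding UNIV_5 by (simp add: ac_simps)

lemma blinfun_apply_dcoord [simp]: "blinfun_apply (dcoord i) v = v $ i"
  by transfer simp

lemma contact_form_apply:
  "blinfun_apply (contact_form P) v = v $ 3 - P $ 4 * v $ 1 - P $ 5 * v $ 2"
  by (simp add: contact_form_def blinfun.diff_left blinfun.scaleR_left)

lemma second_form_apply:
  "blinfun_apply (second_form \<alpha> P) v = v $ 4 - \<alpha> P * v $ 5"
  by (simp add: second_form_def blinfun.diff_left blinfun.scaleR_left)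

lemma jet_basis_expansion:
  "v = (\<Sum>i\<in>UNIV. v $ i *\<^sub>R axis (i::5) (1::real))"
  by (simp add: vec_eq_iff axis_def if_distrib sum.delta cong: if_cong)

lemma frechet_derivative_pd:
  assumes "f differentiable (at P)"
  shows "frechet_derivative f (at P) v =
    v $ 1 * pd 1 f P + v $ 2 * pd 2 f P + v $ 3 * pd 3 f P + v $ 4 * pd 4 f P + v $ 5 * pd 5 f P"
proof -
  note lin = linear_frechet_derivative[OF assms]
  have "frechet_derivative f (at P) v = (\<Sum>i\<in>UNIV. v $ i * pd i f P)"
    by (subst jet_basis_expansion[of v]) (simp add: linear_sum[OF lin] linear_cmul[OF lin] pd_def)
  then show ?thesis by (simp add: sum_5)
qed

lemma contact_form_has_derivative:
  "(contact_form has_derivative (\<lambda>u. - u $ 4 *\<^sub>R dcoord 1 - u $ 5 *\<^sub>R dcoord 2)) (at P)"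
proof -
  have "((\<lambda>P. dcoord 3 - (P $ 4) *\<^sub>R dcoord 1 - (P $ 5) *\<^sub>R dcoord 2 :: jet \<Rightarrow>\<^sub>L real) has_derivative
      (\<lambda>u. - u $ 4 *\<^sub>R dcoord 1 - u $ 5 *\<^sub>R dcoord 2)) (at P)"
    by (auto intro!: derivative_eq_intros bounded_linear.has_derivative[OF bounded_linear_vec_nth])
  then show ?thesis by (simp add: contact_form_def[abs_def])
qed

lemma second_form_has_derivative:
  assumes "(\<alpha> has_derivative \<alpha>') (at P)"
  shows "(second_form \<alpha> has_derivative (\<lambda>u. - (\<alpha>' u *\<^sub>R dcoord 5))) (at P)"
proof -
  have "((\<lambda>P. dcoord 4 - \<alpha> P *\<^sub>R dcoord 5 :: jet \<Rightarrow>\<^sub>L real) has_derivative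
      (\<lambda>u. - (\<alpha>' u *\<^sub>R dcoord 5))) (at P)"
    by (auto intro!: derivative_eq_intros assms)
  then show ?thesis by (simp add: second_form_def[abs_def])
qed

section \<open>Smooth sections and pullback of their derivatives\<close>

lemma smooth_on_cong:
  "open M \<Longrightarrow> (\<And>P. P \<in> M \<Longrightarrow> f P = g P) \<Longrightarrow> smooth_on M f \<Longrightarrow> smooth_on M g"
  using higher_differentiable_on_cong unfolding smooth_on_def by blast

text \<open>Derivatives are known to be smooth in fixed directions, so the varying direction
  \<open>F w\<close> is expanded in the standard basis.\<close>

lemma smooth_on_ext_deriv_pair:
  fixes \<theta> :: "'a::euclidean_space \<Rightarrow> ('a \<Rightarrow>\<^sub>L real)"
  assumes "open M" "smooth_on M \<theta>" "smooth_on M F" "smooth_on M G"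
  shows "smooth_on M (\<lambda>w. ext_deriv_pair \<theta> w (F w) (G w))"
proof -
  have "smooth_on M (\<lambda>w. blinfun_apply (frechet_derivative \<theta> (at w) (F w)) (G w))"
    if "smooth_on M F" "smooth_on M G" for F G
  proof -
    have "smooth_on M (\<lambda>w. \<Sum>b\<in>Basis. (F w \<bullet> b) *\<^sub>R frechet_derivative \<theta> (at w) b)"
      by (intro smooth_on_sum smooth_on_scaleR smooth_on_inner smooth_on_const
          smooth_on_frechet_derivative assms that finite_Basis)
    then have "smooth_on M (\<lambda>w. frechet_derivative \<theta> (at w) (F w))"
    proof (rule smooth_on_cong[OF \<open>open M\<close>, rotated])
      fix w assume "w \<in> M"
      note lin = linear_frechet_derivative[OF smooth_on_differentiable[OF assms(2) this]]
      show "(\<Sum>b\<in>Basis. (F w \<bullet> b) *\<^sub>R frechet_derivative \<theta> (at w) b) = frechet_derivative \<theta> (at w) (F w)"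
        by (subst (2) euclidean_representation[symmetric])
          (simp only: linear_sum[OF lin] linear_cmul[OF lin])
    qed
    then show ?thesis using that by (intro smooth_on_blinfun_apply assms)
  qed
  from smooth_on_diff[OF assms(1) this[OF assms(3,4)] this[OF assms(4,3)]] show ?thesis
    unfolding ext_deriv_pair_def .
qed


text \<open>The coefficients of \<open>\<theta>\<^sub>0\<close> in the frame at \<open>m\<close> are
  kept constant over \<open>M\<close>.\<close>

lemma smooth_frame_on_section:
  assumes "open M" "smooth_frame_on M \<theta>s J" "m \<in> M" "\<theta>\<^sub>0 \<in> J m"
  obtains \<theta> where "smooth_on M \<theta>" "\<theta> m = \<theta>\<^sub>0" "\<And>P. P \<in> M \<Longrightarrow> \<theta> P \<in> J P"
proof -
  have J: "J P = span ((\<lambda>\<theta>. \<theta> P) ` set \<theta>s)" if "P \<in> M" for P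
    using assms(2) that by (simp add: smooth_frame_on_def)
  have "\<theta>\<^sub>0 \<in> span ((\<lambda>\<theta>. \<theta> m) ` set \<theta>s)" using assms J by simp
  then have "\<exists>\<theta>. smooth_on M \<theta> \<and> \<theta> m = \<theta>\<^sub>0 \<and> (\<forall>P\<in>M. \<theta> P \<in> J P)"
  proof (induction rule: span_induct_alt)
    case base
    show ?case using J by (intro exI[of _ "\<lambda>P. 0"]) (auto simp: smooth_on_const span_zero)
  next
    case (step c x y)
    from step(1) obtain \<eta> where \<eta>: "\<eta> \<in> set \<theta>s" "x = \<eta> m" by auto
    from step(2) obtain \<theta> where \<theta>: "smooth_on M \<theta>" "\<theta> m = y" "\<forall>P\<in>M. \<theta> P \<in> J P" by auto
    have "smooth_on M \<eta>" using assms(2) \<eta> by (simp add: smooth_frame_on_def)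
    then have "smooth_on M (\<lambda>P. c *\<^sub>R \<eta> P + \<theta> P)"
      by (intro smooth_on_add smooth_on_scaleR smooth_on_const \<theta> assms)
    moreover have "\<forall>P\<in>M. c *\<^sub>R \<eta> P + \<theta> P \<in> J P"
      using J \<eta> \<theta>(3) by (auto intro!: span_add span_scale intro: span_base)
    ultimately show ?case using \<eta> \<theta> by (intro exI[of _ "\<lambda>P. c *\<^sub>R \<eta> P + \<theta> P"]) auto
  qed
  then show ?thesis using that by blast
qed

text \<open>The exterior derivative commutes with pullback: the terms with second derivatives of
  \<pi> cancel by symmetry.\<close>

lemma pullback_pair:
  fixes \<pi> :: "'a::euclidean_space \<Rightarrow> 'b::euclidean_space"
  assumes "open V" "P \<in> V" "smooth_on V \<pi>" "\<theta> differentiable (at (\<pi> P))"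
  shows "ext_deriv_pair \<theta> (\<pi> P) (frechet_derivative \<pi> (at P) u) (frechet_derivative \<pi> (at P) v) =
    frechet_derivative (\<lambda>R. blinfun_apply (\<theta> (\<pi> R)) (frechet_derivative \<pi> (at R) v)) (at P) u -
    frechet_derivative (\<lambda>R. blinfun_apply (\<theta> (\<pi> R)) (frechet_derivative \<pi> (at R) u)) (at P) v"
proof -
  let ?D = "\<lambda>R. frechet_derivative \<pi> (at R)"
  have "((\<lambda>R. blinfun_apply (\<theta> (\<pi> R)) (?D R v)) has_derivative
    (\<lambda>u. blinfun_apply (\<theta> (\<pi> P)) (frechet_derivative (\<lambda>R. ?D R v) (at P) u) +
      blinfun_apply (frechet_derivative \<theta> (at (\<pi> P)) (?D P u)) (?D P v))) (at P)" for v
    by (intro bounded_bilinear.FDERIV[OF bounded_bilinear_blinfun_apply]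
        has_derivative_compose[OF smooth_on_has_derivative[OF assms(3,2)]]
        smooth_on_has_derivative[OF smooth_on_frechet_derivative[OF assms(3)] assms(2)]
        assms(4)[unfolded frechet_derivative_works])
  from frechet_derivative_at[OF this, symmetric] show ?thesis
    by (simp add: ext_deriv_pair_def symmetric_second_derivative[OF assms(1-3), of u v])
qed

section \<open>The derived form on the jet space\<close>

lemma smooth_on_ident: "smooth_on M (\<lambda>P. P)"
proof -
  have "higher_differentiable_on M (\<lambda>P. P) k" for k
    by (cases k) (simp_all add: higher_differentiable_on_const)
  then show ?thesis by (simp add: smooth_on_def)
qed

lemma smooth_on_vec_nth: "open M \<Longrightarrow> smooth_on M (\<lambda>P :: real ^ 'n. P $ i)"
  unfolding cart_eq_inner_axis by (intro smooth_on_inner smooth_on_ident smooth_on_const)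

lemma smooth_on_pd: "smooth_on M f \<Longrightarrow> smooth_on M (pd i f)"
  unfolding pd_def[abs_def] by (rule smooth_on_frechet_derivative)

lemma smooth_on_total_y: "open M \<Longrightarrow> smooth_on M \<alpha> \<Longrightarrow> smooth_on M (total_y \<alpha>)"
  unfolding total_y_def[abs_def]
  by (intro smooth_on_add smooth_on_mult smooth_on_vec_nth smooth_on_pd)

lemma pd_commute: "open M \<Longrightarrow> P \<in> M \<Longrightarrow> smooth_on M f \<Longrightarrow> pd i (pd j f) P = pd j (pd i f) P"
  unfolding pd_def[abs_def] by (rule symmetric_second_derivative)

lemma pd_eqI: "(f has_derivative f') (at P) \<Longrightarrow> pd i f P = f' (axis i 1)"
  unfolding pd_def by (simp flip: frechet_derivative_at)

lemma has_derivative_vec_nth: "((\<lambda>P :: real ^ 'n. P $ i) has_derivative (\<lambda>u. u $ i)) F"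
  by (rule bounded_linear_imp_has_derivative[OF bounded_linear_vec_nth])

text \<open>The last term differentiates the coefficient \<open>P $ 5\<close> and is present only
  for \<open>i = 5\<close>.\<close>

lemma pd_total_y:
  assumes "open M" "P \<in> M" "smooth_on M \<alpha>"
  shows "pd i (total_y \<alpha>) P =
    pd i (pd 2 \<alpha>) P + P $ 5 * pd i (pd 3 \<alpha>) P + axis i 1 $ 5 * pd 3 \<alpha> P"
proof -
  note d = smooth_on_has_derivative[OF smooth_on_pd[OF assms(3)] assms(2)]
  show ?thesis
    unfolding total_y_def[abs_def]
    by (subst pd_eqI[OF has_derivative_add[OF d has_derivative_mult[OF has_derivative_vec_nth d]]])
      (simp add: pd_def)
qed

text \<open>D applied twice to \<alpha>. D annihilates its own coefficient q, so no first-order term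
  appears; the result is the second left-hand side of the star condition.\<close>

lemma total_y_total_y:
  assumes "open M" "P \<in> M" "smooth_on M \<alpha>"
  shows "pd 2 (total_y \<alpha>) P + P $ 5 * pd 3 (total_y \<alpha>) P =
    pd 2 (pd 2 \<alpha>) P + 2 * P $ 5 * pd 3 (pd 2 \<alpha>) P + (P $ 5)\<^sup>2 * pd 3 (pd 3 \<alpha>) P"
  using pd_commute[OF assms, of 2 3]
  by (simp add: pd_total_y[OF assms] axis_def algebra_simps power2_eq_square)

text \<open>With \<open>X = \<partial>\<^sub>x + p \<partial>\<^sub>z - \<alpha> D\<close> one has \<open>[X, D] = (D \<alpha>) D\<close>, and \<open>X \<alpha> = 0\<close> by involutivity.\<close>

lemma involutive_characteristic_derivative:
  assumes "open U" "smooth_on U \<alpha>" "involutive_type_on U \<alpha>" "P \<in> U"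
  shows "pd 1 (total_y \<alpha>) P + P $ 4 * pd 3 (total_y \<alpha>) P -
    \<alpha> P * (pd 2 (total_y \<alpha>) P + P $ 5 * pd 3 (total_y \<alpha>) P) = (total_y \<alpha> P)\<^sup>2"
proof -
  let ?E = "\<lambda>P. pd 1 \<alpha> P + P $ 4 * pd 3 \<alpha> P - \<alpha> P * total_y \<alpha> P"
  note der = smooth_on_has_derivative[OF _ assms(4)]
  note d = der[OF smooth_on_pd[OF assms(2)]] der[OF assms(2)] der[OF smooth_on_total_y[OF assms(1,2)]]
  note E = has_derivative_diff[OF has_derivative_add[OF d(1) has_derivative_mult[OF has_derivative_vec_nth d(1)]]
      has_derivative_mult[OF d(2,3)]]
  have "(?E has_derivative (\<lambda>u. 0)) (at P)"
    by (rule has_derivative_transform_within_open[OF has_derivative_const \<open>open U\<close> \<open>P \<in> U\<close>])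
      (use assms(3) in \<open>simp add: involutive_type_on_def\<close>)
  then have "pd i ?E P = 0" for i by (simp add: pd_eqI)
  then have eq: "pd i (pd 1 \<alpha>) P + (P $ 4 * pd i (pd 3 \<alpha>) P + axis i 1 $ 4 * pd 3 \<alpha> P) -
      (\<alpha> P * pd i (total_y \<alpha>) P + pd i \<alpha> P * total_y \<alpha> P) = 0" for i
    by (subst (asm) pd_eqI[OF E]) (simp add: pd_def)
  have Dy: "total_y \<alpha> P = pd 2 \<alpha> P + P $ 5 * pd 3 \<alpha> P" by (simp add: total_y_def)
  \<comment> \<open>The y-derivative plus q times the z-derivative of the involutivity equation;
    symmetry moves D past the partial derivatives in x and z.\<close>
  have "pd 1 (total_y \<alpha>) P + P $ 4 * pd 3 (total_y \<alpha>) P -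
      \<alpha> P * (pd 2 (total_y \<alpha>) P + P $ 5 * pd 3 (total_y \<alpha>) P) =
      (pd 2 \<alpha> P + P $ 5 * pd 3 \<alpha> P) * total_y \<alpha> P"
    using eq[of 2] eq[of 3] pd_commute[OF assms(1,4,2), of 1 2] pd_commute[OF assms(1,4,2), of 1 3]
      pd_commute[OF assms(1,4,2), of 2 3]
      pd_total_y[OF assms(1,4,2), of 1] pd_total_y[OF assms(1,4,2), of 3]
    by (simp add: axis_def) algebra
  then show ?thesis by (simp add: power2_eq_square flip: Dy)
qed

section \<open>The exterior derivative of \<omega>' on its kernel\<close>

text \<open>The algebra behind d\<omega>'. Here \<open>su\<close>, \<open>sv\<close> are values of
  the contact form, \<open>a1\<close> to \<open>a5\<close> and \<open>t1\<close> to
  \<open>t5\<close> are partial derivatives of \<alpha> and \<open>T\<close>, \<open>d\<close> is D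
  applied to \<open>T\<close>, and \<open>e\<close> is the first left-hand side of the star
  condition. The kernel equations eliminate \<open>u3\<close>, \<open>u4\<close>, \<open>v3\<close>,
  \<open>v4\<close>; involutivity and its derivative along D eliminate \<open>a1\<close> and
  \<open>t1\<close>.\<close>

lemma wedge_identity:
  fixes a :: real
  assumes "u3 = p * u1 + q * u2 + su" "u4 = a * u5 - T * su"
    and "v3 = p * v1 + q * v2 + sv" "v4 = a * v5 - T * sv"
    and "a1 = a * T - p * a3" "a2 = T - q * a3"
    and "t1 = T * T + a * d - p * t3" "t2 = d - q * t3"
    and "e = a4 * T - a * t4 - t5 - a3"
  shows "(u1 * t1 + u2 * t2 + u3 * t3 + u4 * t4 + u5 * t5) * sv -
      (v1 * t1 + v2 * t2 + v3 * t3 + v4 * t4 + v5 * t5) * su +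
      T * (v4 * u1 + v5 * u2 - u4 * v1 - u5 * v2) +
      ((v1 * a1 + v2 * a2 + v3 * a3 + v4 * a4 + v5 * a5) * u5 -
       (u1 * a1 + u2 * a2 + u3 * a3 + u4 * a4 + u5 * a5) * v5) =
    (d * (a * u1 + u2) - e * u5) * sv - (d * (a * v1 + v2) - e * v5) * su"
  unfolding assms by (simp add: algebra_simps)

text \<open>The values of \<open>d\<omega>\<^sub>0\<close> and \<open>d\<omega>\<^sub>1\<close> on a pair of vectors.\<close>

definition contact_pair :: "jet \<Rightarrow> jet \<Rightarrow> real" where
  "contact_pair u v = v $ 4 * u $ 1 + v $ 5 * u $ 2 - u $ 4 * v $ 1 - u $ 5 * v $ 2"

definition second_pair :: "(jet \<Rightarrow> real) \<Rightarrow> jet \<Rightarrow> jet \<Rightarrow> jet \<Rightarrow> real" where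
  "second_pair \<alpha> P u v =
     frechet_derivative \<alpha> (at P) v * u $ 5 - frechet_derivative \<alpha> (at P) u * v $ 5"

text \<open>\<open>d\<omega>'\<close>, whose values matter on the kernel of \<open>\<omega>' = \<omega>\<^sub>1 + T \<omega>\<^sub>0\<close>.\<close>

definition derived_pair :: "(jet \<Rightarrow> real) \<Rightarrow> jet \<Rightarrow> jet \<Rightarrow> jet \<Rightarrow> real" where
  "derived_pair \<alpha> P u v =
     frechet_derivative (total_y \<alpha>) (at P) u * blinfun_apply (contact_form P) v -
     frechet_derivative (total_y \<alpha>) (at P) v * blinfun_apply (contact_form P) u +
     total_y \<alpha> P * contact_pair u v + second_pair \<alpha> P u v"

definition derived_kernel :: "(jet \<Rightarrow> real) \<Rightarrow> jet \<Rightarrow> jet set" where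
  "derived_kernel \<alpha> P =
     {v. total_y \<alpha> P * blinfun_apply (contact_form P) v + blinfun_apply (second_form \<alpha> P) v = 0}"

lemma derived_pair_expansion:
  assumes "open U" "smooth_on U \<alpha>" "involutive_type_on U \<alpha>" "P \<in> U"
    and "u \<in> derived_kernel \<alpha> P" "v \<in> derived_kernel \<alpha> P"
    and "D2 = pd 2 (pd 2 \<alpha>) P + 2 * P $ 5 * pd 3 (pd 2 \<alpha>) P + (P $ 5)\<^sup>2 * pd 3 (pd 3 \<alpha>) P"
    and "e = pd 4 \<alpha> P * total_y \<alpha> P - \<alpha> P * pd 4 (total_y \<alpha>) P - pd 5 (total_y \<alpha>) P - pd 3 \<alpha> P"
  shows "derived_pair \<alpha> P u v =
    (D2 * (\<alpha> P * u $ 1 + u $ 2) - e * u $ 5) * blinfun_apply (contact_form P) v -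
    (D2 * (\<alpha> P * v $ 1 + v $ 2) - e * v $ 5) * blinfun_apply (contact_form P) u"
proof -
  have D2: "pd 2 (total_y \<alpha>) P = D2 - P $ 5 * pd 3 (total_y \<alpha>) P"
    using total_y_total_y[OF assms(1,4,2)] assms(7) by simp
  have T1: "pd 1 (total_y \<alpha>) P = total_y \<alpha> P * total_y \<alpha> P + \<alpha> P * D2 - P $ 4 * pd 3 (total_y \<alpha>) P"
    using involutive_characteristic_derivative[OF assms(1-4)]
    by (simp add: D2 power2_eq_square)
  have a1: "pd 1 \<alpha> P = \<alpha> P * total_y \<alpha> P - P $ 4 * pd 3 \<alpha> P"
    using bspec[OF assms(3)[unfolded involutive_type_on_def] assms(4)] by linarith
  have a2: "pd 2 \<alpha> P = total_y \<alpha> P - P $ 5 * pd 3 \<alpha> P"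
    by (simp add: total_y_def)
  have c: "w $ 3 = P $ 4 * w $ 1 + P $ 5 * w $ 2 + blinfun_apply (contact_form P) w"
    "w $ 4 = \<alpha> P * w $ 5 - total_y \<alpha> P * blinfun_apply (contact_form P) w"
    if "w \<in> derived_kernel \<alpha> P" for w
    using that by (simp_all add: derived_kernel_def second_form_apply contact_form_apply)
  show ?thesis
    unfolding derived_pair_def second_pair_def contact_pair_def
      frechet_derivative_pd[OF smooth_on_differentiable[OF assms(2,4)]]
      frechet_derivative_pd[OF smooth_on_differentiable[OF smooth_on_total_y[OF assms(1,2)] assms(4)]]
    by (rule wedge_identity[OF c[OF assms(5)] c[OF assms(6)] a1 a2 T1 D2 assms(8)])
qed

lemma derived_pair_vanishes_iff:
  assumes "open U" "smooth_on U \<alpha>" "involutive_type_on U \<alpha>" "P \<in> U"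
  shows "(\<forall>u\<in>derived_kernel \<alpha> P. \<forall>v\<in>derived_kernel \<alpha> P. derived_pair \<alpha> P u v = 0) \<longleftrightarrow>
    star_condition \<alpha> P"
proof -
  define D2 where "D2 = pd 2 (pd 2 \<alpha>) P + 2 * P $ 5 * pd 3 (pd 2 \<alpha>) P + (P $ 5)\<^sup>2 * pd 3 (pd 3 \<alpha>) P"
  define e where "e = pd 4 \<alpha> P * total_y \<alpha> P - \<alpha> P * pd 4 (total_y \<alpha>) P - pd 5 (total_y \<alpha>) P - pd 3 \<alpha> P"
  note exp = derived_pair_expansion[OF assms _ _ D2_def e_def]
  have star: "star_condition \<alpha> P \<longleftrightarrow> e = 0 \<and> D2 = 0"
    by (simp add: star_condition_def D2_def e_def)
  \<comment> \<open>Here \<open>r\<close> has contact value 1, while \<open>b\<close>, which is D,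
    and \<open>c\<close>, which is \<open>\<partial>\<^sub>q + \<alpha> \<partial>\<^sub>p\<close>,
    have contact value 0; pairing them with \<open>r\<close> reads off \<open>D2\<close> and
    \<open>- e\<close>.\<close>
  define r :: jet where "r = axis 3 1 - total_y \<alpha> P *\<^sub>R axis 4 1"
  define b :: jet where "b = axis 2 1 + P $ 5 *\<^sub>R axis 3 1"
  define c :: jet where "c = axis 5 1 + \<alpha> P *\<^sub>R axis 4 1"
  have comps: "r $ 1 = 0" "r $ 2 = 0" "r $ 3 = 1" "r $ 4 = - total_y \<alpha> P" "r $ 5 = 0"
    "b $ 1 = 0" "b $ 2 = 1" "b $ 3 = P $ 5" "b $ 4 = 0" "b $ 5 = 0"
    "c $ 1 = 0" "c $ 2 = 0" "c $ 3 = 0" "c $ 4 = \<alpha> P" "c $ 5 = 1"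
    by (simp_all add: r_def b_def c_def axis_def)
  have mem: "r \<in> derived_kernel \<alpha> P" "b \<in> derived_kernel \<alpha> P" "c \<in> derived_kernel \<alpha> P"
    by (simp_all add: derived_kernel_def contact_form_apply second_form_apply comps)
  have "derived_pair \<alpha> P b r = D2" "derived_pair \<alpha> P c r = - e"
    unfolding exp[OF mem(2,1)] exp[OF mem(3,1)] contact_form_apply comps by simp_all
  moreover have "derived_pair \<alpha> P u v = 0"
    if "e = 0" "D2 = 0" "u \<in> derived_kernel \<alpha> P" "v \<in> derived_kernel \<alpha> P" for u v
    unfolding exp[OF that(3,4)] that(1,2) by simp
  ultimately show ?thesis unfolding star using mem by (metis neg_equal_0_iff_equal)
qed

section \<open>The first derived system of the reduction\<close>

locale jet_reduction =
  fixes \<alpha> :: "jet \<Rightarrow> real" and U V :: "jet set"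
    and \<pi> :: "jet \<Rightarrow> real ^ 4" and W :: "(real ^ 4) set"
    and J :: "real ^ 4 \<Rightarrow> ((real ^ 4) \<Rightarrow>\<^sub>L real) set"
  assumes open_U: "open U" and smooth_\<alpha>: "smooth_on U \<alpha>"
    and involutive: "involutive_type_on U \<alpha>"
    and V_subset: "V \<subseteq> U" and reduction: "reduction \<alpha> V \<pi> W J"
begin

abbreviation d\<pi> :: "jet \<Rightarrow> jet \<Rightarrow> real ^ 4" where
  "d\<pi> P \<equiv> frechet_derivative \<pi> (at P)"

abbreviation \<omega>\<^sub>0 :: "jet \<Rightarrow> jet \<Rightarrow> real" where
  "\<omega>\<^sub>0 P \<equiv> blinfun_apply (contact_form P)"

abbreviation \<omega>\<^sub>1 :: "jet \<Rightarrow> jet \<Rightarrow> real" where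
  "\<omega>\<^sub>1 P \<equiv> blinfun_apply (second_form \<alpha> P)"

abbreviation T :: "jet \<Rightarrow> real" where
  "T \<equiv> total_y \<alpha>"

lemma open_V: "open V" and open_W: "open W" and smooth_\<pi>: "smooth_on V \<pi>" and image_V: "\<pi> ` V = W"
  and surj_d\<pi>: "P \<in> V \<Longrightarrow> surj (d\<pi> P)"
  using reduction by (auto simp: reduction_def leaf_space_projection_def)

lemma in_U: "P \<in> V \<Longrightarrow> P \<in> U"
  using V_subset by blast

lemma in_W: "P \<in> V \<Longrightarrow> \<pi> P \<in> W"
  using image_V by blast

lemma lift_point:
  assumes "w \<in> W" obtains P where "P \<in> V" "w = \<pi> P"
  using assms image_V by blast

lemma lift_vector:
  assumes "P \<in> V" obtains v where "y = d\<pi> P v"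
  using surj_d\<pi>[OF assms] by (metis surjD)

lemma linear_d\<pi>: "P \<in> V \<Longrightarrow> linear (d\<pi> P)"
  using linear_frechet_derivative smooth_on_differentiable smooth_\<pi> by blast

lemma frame_exists: "\<exists>\<theta>s. smooth_frame_on W \<theta>s J \<and>
    jet_system V \<alpha> = alg_ideal V (pullback \<pi> ` diff_ideal W (one_form ` set \<theta>s))"
  using reduction by (simp add: reduction_def)

text \<open>One choice among the frames that \<open>reduction\<close> provides, so that all later
  lemmas share it.\<close>

definition frame :: "(real ^ 4 \<Rightarrow> ((real ^ 4) \<Rightarrow>\<^sub>L real)) list" where
  "frame = (SOME \<theta>s. smooth_frame_on W \<theta>s J \<and>
    jet_system V \<alpha> = alg_ideal V (pullback \<pi> ` diff_ideal W (one_form ` set \<theta>s)))"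

lemma smooth_frame: "smooth_frame_on W frame J"
  and jet_system_eq: "jet_system V \<alpha> = alg_ideal V (pullback \<pi> ` diff_ideal W (one_form ` set frame))"
  using someI_ex[OF frame_exists] by (simp_all add: frame_def)

lemma J_eq_span: "w \<in> W \<Longrightarrow> J w = span ((\<lambda>\<theta>. \<theta> w) ` set frame)"
  using smooth_frame by (simp add: smooth_frame_on_def)

lemma subspace_J: "w \<in> W \<Longrightarrow> subspace (J w)"
  by (simp add: J_eq_span)

section \<open>Pullbacks of covectors in \<open>J\<close>\<close>

text \<open>The two descriptions of the ideal have the same part of degree one. In each direction
  the generators of one description vanish on the vector in degrees zero and one, hence so does the
  whole ideal.\<close>

lemma kernel_J_iff:
  assumes "P \<in> V"
  shows "d\<pi> P v \<in> common_kernel (J (\<pi> P)) \<longleftrightarrow> \<omega>\<^sub>0 P v = 0 \<and> \<omega>\<^sub>1 P v = 0"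
proof
  assume "d\<pi> P v \<in> common_kernel (J (\<pi> P))"
  then have v: "d\<pi> P v \<in> common_kernel ((\<lambda>\<theta>. \<theta> (\<pi> P)) ` set frame)"
    by (simp add: J_eq_span in_W assms common_kernel_span)
  have "\<omega> P [v] = 0" if "\<omega> \<in> jet_system V \<alpha>" for \<omega>
  proof -
    have "\<omega> P [] = 0 \<and> (\<forall>v'\<in>{v}. \<omega> P [v'] = 0)"
      using that[unfolded jet_system_eq] assms
    proof (rule alg_ideal_low_degree)
      fix \<gamma> assume "\<gamma> \<in> pullback \<pi> ` diff_ideal W (one_form ` set frame)"
      then obtain \<eta> where \<eta>: "\<eta> \<in> diff_ideal W (one_form ` set frame)" "\<gamma> = pullback \<pi> \<eta>" by auto
      show "\<gamma> P [] = 0 \<and> (\<forall>v'\<in>{v}. \<gamma> P [v'] = 0)"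
        using diff_ideal_one_forms_low_degree[OF \<eta>(1) in_W[OF assms]] v
        by (simp add: \<eta>(2) pullback_def)
    qed
    then show ?thesis by simp
  qed
  moreover have "one_form contact_form \<in> jet_system V \<alpha>" "one_form (second_form \<alpha>) \<in> jet_system V \<alpha>"
    by (auto simp: jet_system_def diff_ideal_def intro: alg_ideal.gen)
  ultimately show "\<omega>\<^sub>0 P v = 0 \<and> \<omega>\<^sub>1 P v = 0"
    by (force simp: one_form_def covector_def)
next
  assume v: "\<omega>\<^sub>0 P v = 0 \<and> \<omega>\<^sub>1 P v = 0"
  have "blinfun_apply (\<theta> (\<pi> P)) (d\<pi> P v) = 0" if "\<theta> \<in> set frame" for \<theta>
  proof -
    have "pullback \<pi> (one_form \<theta>) \<in> jet_system V \<alpha>"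
      unfolding jet_system_eq diff_ideal_def by (intro alg_ideal.gen imageI) (use that in auto)
    then have "pullback \<pi> (one_form \<theta>) \<in> diff_ideal V (one_form ` {contact_form, second_form \<alpha>})"
      by (simp add: jet_system_def)
    from diff_ideal_one_forms_low_degree[OF this assms]
    have "pullback \<pi> (one_form \<theta>) P [v] = 0" using v by (simp add: common_kernel_def)
    then show ?thesis by (simp add: pullback_def one_form_def covector_def)
  qed
  then show "d\<pi> P v \<in> common_kernel (J (\<pi> P))"
    by (simp add: J_eq_span in_W assms common_kernel_span) (simp add: common_kernel_def)
qed

text \<open>For a section of \<open>J\<close> the indices 3 and 4 give the coefficients of
  \<open>\<omega>\<^sub>0\<close> and \<open>\<omega>\<^sub>1\<close> in its pullback, because the z
  and p directions are dual to these two forms.\<close>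

definition coef :: "5 \<Rightarrow> (real ^ 4 \<Rightarrow> ((real ^ 4) \<Rightarrow>\<^sub>L real)) \<Rightarrow> jet \<Rightarrow> real" where
  "coef i \<theta> P = blinfun_apply (\<theta> (\<pi> P)) (d\<pi> P (axis i 1))"

text \<open>Correcting \<open>v\<close> along the z and p directions leaves a vector on which both
  forms vanish, and \<mu> vanishes on its image by \<open>kernel_J_iff\<close>.\<close>

lemma pullback_J:
  assumes "P \<in> V" "\<mu> \<in> J (\<pi> P)"
  shows "blinfun_apply \<mu> (d\<pi> P v) = blinfun_apply \<mu> (d\<pi> P (axis 3 1)) * \<omega>\<^sub>0 P v + blinfun_apply \<mu> (d\<pi> P (axis 4 1)) * \<omega>\<^sub>1 P v"
proof -
  let ?w = "v - \<omega>\<^sub>0 P v *\<^sub>R axis 3 1 - \<omega>\<^sub>1 P v *\<^sub>R axis 4 1"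
  have "\<omega>\<^sub>0 P ?w = 0" "\<omega>\<^sub>1 P ?w = 0"
    by (simp_all add: contact_form_apply second_form_apply axis_def)
  then have "blinfun_apply \<mu> (d\<pi> P ?w) = 0"
    using kernel_J_iff[OF assms(1), of ?w] assms(2) by (auto simp: common_kernel_def)
  then show ?thesis
    by (simp add: linear_diff[OF linear_d\<pi>[OF assms(1)]] linear_cmul[OF linear_d\<pi>[OF assms(1)]]
        blinfun.diff_right blinfun.scaleR_right mult.commute)
qed

text \<open>Both forms vanish on the kernel of \<open>d\<pi> P\<close>, so their combinations
  descend; a linear right inverse of \<open>d\<pi> P\<close> writes down the descended
  covector.\<close>

lemma J_element_exists:
  assumes "P \<in> V"
  obtains \<mu> where "\<mu> \<in> J (\<pi> P)" "\<And>v. blinfun_apply \<mu> (d\<pi> P v) = a * \<omega>\<^sub>0 P v + b * \<omega>\<^sub>1 P v"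
proof -
  obtain g where g: "linear g" "d\<pi> P \<circ> g = id"
    using linear_surjective_right_inverse[OF linear_d\<pi> surj_d\<pi>] assms by blast
  have inv: "d\<pi> P (g y) = y" for y using g(2) by (metis comp_apply id_apply)
  define \<mu> where "\<mu> = Blinfun (\<lambda>y. a * \<omega>\<^sub>0 P (g y) + b * \<omega>\<^sub>1 P (g y))"
  have "linear (\<lambda>y. a * \<omega>\<^sub>0 P (g y) + b * \<omega>\<^sub>1 P (g y))"
    using g(1) by (simp add: linear_iff blinfun.add_right blinfun.scaleR_right algebra_simps)
  then have \<mu>: "blinfun_apply \<mu> y = a * \<omega>\<^sub>0 P (g y) + b * \<omega>\<^sub>1 P (g y)" for y
    by (simp add: \<mu>_def bounded_linear_Blinfun_apply linear_conv_bounded_linear)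
  have "blinfun_apply \<mu> (d\<pi> P v) = a * \<omega>\<^sub>0 P v + b * \<omega>\<^sub>1 P v" for v
  proof -
    \<comment> \<open>Two lifts of one vector differ by an element of the kernel; its image 0 lies
      in every annihilator, so \<open>kernel_J_iff\<close> applies.\<close>
    have "d\<pi> P (g (d\<pi> P v) - v) = 0"
      using linear_diff[OF linear_d\<pi>[OF assms]] inv by simp
    then have "\<omega>\<^sub>0 P (g (d\<pi> P v) - v) = 0 \<and> \<omega>\<^sub>1 P (g (d\<pi> P v) - v) = 0"
      using kernel_J_iff[OF assms, of "g (d\<pi> P v) - v"] by (simp add: common_kernel_def blinfun.zero_right)
    then show ?thesis by (simp add: \<mu> blinfun.diff_right)
  qed
  moreover have "\<mu> \<in> J (\<pi> P)"
    unfolding J_eq_span[OF in_W[OF assms]]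
  proof (rule in_span_if_vanishes_on_common_kernel)
    fix y assume "y \<in> common_kernel ((\<lambda>\<theta>. \<theta> (\<pi> P)) ` set frame)"
    then have "d\<pi> P (g y) \<in> common_kernel (J (\<pi> P))"
      by (simp add: inv J_eq_span in_W assms common_kernel_span)
    then show "blinfun_apply \<mu> y = 0" using kernel_J_iff[OF assms] by (simp add: \<mu>)
  qed simp
  ultimately show ?thesis using that by blast
qed

lemma pullback_determines:
  assumes "P \<in> V" "\<And>v. blinfun_apply \<mu> (d\<pi> P v) = blinfun_apply \<nu> (d\<pi> P v)"
  shows "\<mu> = \<nu>"
  using assms(2) lift_vector[OF assms(1)] by (metis blinfun_eqI)

section \<open>Exterior derivatives of sections of \<open>J\<close>\<close>

lemma coef_differentiable:
  assumes "P \<in> V" "\<theta> differentiable (at (\<pi> P))"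
  shows "coef i \<theta> differentiable (at P)"
proof -
  have "((\<lambda>R. blinfun_apply (\<theta> (\<pi> R)) (d\<pi> R v)) has_derivative
    (\<lambda>u. blinfun_apply (\<theta> (\<pi> P)) (frechet_derivative (\<lambda>R. d\<pi> R v) (at P) u) +
      blinfun_apply (frechet_derivative \<theta> (at (\<pi> P)) (d\<pi> P u)) (d\<pi> P v))) (at P)" for v
    by (intro bounded_bilinear.FDERIV[OF bounded_bilinear_blinfun_apply]
        has_derivative_compose[OF smooth_on_has_derivative[OF smooth_\<pi> assms(1)]]
        smooth_on_has_derivative[OF smooth_on_frechet_derivative[OF smooth_\<pi>] assms(1)]
        assms(2)[unfolded frechet_derivative_works])
  then show ?thesis by (auto simp: coef_def[abs_def] differentiable_def)
qed

text \<open>This is \<open>d(a \<omega>\<^sub>0 + b \<omega>\<^sub>1) = da \<and> \<omega>\<^sub>0 + db \<and> \<omega>\<^sub>1 + a d\<omega>\<^sub>0 + b d\<omega>\<^sub>1\<close>.\<close>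

lemma section_pair:
  assumes P: "P \<in> V" and N: "open N" "\<pi> P \<in> N" and \<theta>: "smooth_on N \<theta>" "\<And>w. w \<in> N \<Longrightarrow> \<theta> w \<in> J w"
  shows "ext_deriv_pair \<theta> (\<pi> P) (d\<pi> P u) (d\<pi> P v) =
    frechet_derivative (coef 3 \<theta>) (at P) u * \<omega>\<^sub>0 P v - frechet_derivative (coef 3 \<theta>) (at P) v * \<omega>\<^sub>0 P u +
    (frechet_derivative (coef 4 \<theta>) (at P) u * \<omega>\<^sub>1 P v - frechet_derivative (coef 4 \<theta>) (at P) v * \<omega>\<^sub>1 P u) +
    coef 3 \<theta> P * contact_pair u v + coef 4 \<theta> P * second_pair \<alpha> P u v"
proof -
  note diff = smooth_on_differentiable[OF \<theta>(1) N(2)]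
  define M where "M = V \<inter> \<pi> -` N"
  have M: "open M" "P \<in> M"
    using continuous_open_preimage[OF smooth_on_continuous_on[OF smooth_\<pi>] open_V N(1)] P N(2)
    by (auto simp: M_def)
  note c = coef_differentiable[OF P diff, unfolded frechet_derivative_works]
  have 0: "((\<lambda>R. \<omega>\<^sub>0 R v) has_derivative (\<lambda>u. - u $ 4 * v $ 1 - u $ 5 * v $ 2)) (at P)" for v
    using bounded_linear.has_derivative[OF blinfun.bounded_linear_left contact_form_has_derivative, of v P]
    by (simp add: blinfun.diff_left blinfun.scaleR_left blinfun.minus_left)
  have 1: "((\<lambda>R. \<omega>\<^sub>1 R v) has_derivative (\<lambda>u. - (frechet_derivative \<alpha> (at P) u * v $ 5))) (at P)" for v
    using bounded_linear.has_derivative[OF blinfun.bounded_linear_left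
        second_form_has_derivative[OF smooth_on_has_derivative[OF smooth_\<alpha> in_U[OF P]]], of v]
    by (simp add: blinfun.scaleR_left blinfun.minus_left)
  have "((\<lambda>R. blinfun_apply (\<theta> (\<pi> R)) (d\<pi> R v)) has_derivative
    (\<lambda>u. (coef 3 \<theta> P * (- u $ 4 * v $ 1 - u $ 5 * v $ 2) + frechet_derivative (coef 3 \<theta>) (at P) u * \<omega>\<^sub>0 P v) +
      (coef 4 \<theta> P * (- (frechet_derivative \<alpha> (at P) u * v $ 5)) +
       frechet_derivative (coef 4 \<theta>) (at P) u * \<omega>\<^sub>1 P v))) (at P)" for v
    by (rule has_derivative_transform_within_open[OF has_derivative_add[OF
          has_derivative_mult[OF c 0] has_derivative_mult[OF c 1]] M])
      (use \<theta>(2) in \<open>auto simp: M_def coef_def pullback_J[of _ "\<theta> (\<pi> _)" v]\<close>)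
  note this[THEN frechet_derivative_at, symmetric]
  then show ?thesis
    unfolding pullback_pair[OF open_V P smooth_\<pi> diff] contact_pair_def second_pair_def
    by (simp add: algebra_simps)
qed

text \<open>By involutivity d\<alpha> restricts to the common kernel as \<open>T\<close> (dy +
  \<alpha> dx) plus a multiple of dq. Hence the second derivative pair is \<open>- T\<close> times
  the contact pair, and the terms with derivatives of the coefficients drop out.\<close>

lemma section_pair_on_kernel:
  assumes P: "P \<in> V" and N: "open N" "\<pi> P \<in> N" and \<theta>: "smooth_on N \<theta>" "\<And>w. w \<in> N \<Longrightarrow> \<theta> w \<in> J w"
    and u: "\<omega>\<^sub>0 P u = 0" "\<omega>\<^sub>1 P u = 0" and v: "\<omega>\<^sub>0 P v = 0" "\<omega>\<^sub>1 P v = 0"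
  shows "ext_deriv_pair \<theta> (\<pi> P) (d\<pi> P u) (d\<pi> P v) = (coef 3 \<theta> P - T P * coef 4 \<theta> P) * contact_pair u v"
proof -
  have c: "w $ 3 = P $ 4 * w $ 1 + P $ 5 * w $ 2" "w $ 4 = \<alpha> P * w $ 5"
    if "\<omega>\<^sub>0 P w = 0" "\<omega>\<^sub>1 P w = 0" for w
    using that by (simp_all add: second_form_apply contact_form_apply)
  have a1: "pd 1 \<alpha> P = \<alpha> P * T P - P $ 4 * pd 3 \<alpha> P"
    using bspec[OF involutive[unfolded involutive_type_on_def] in_U[OF P]] by linarith
  have a2: "pd 2 \<alpha> P = T P - P $ 5 * pd 3 \<alpha> P"
    by (simp add: total_y_def)
  have "second_pair \<alpha> P u v = - T P * contact_pair u v"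
    unfolding second_pair_def contact_pair_def c[OF u] c[OF v] a1 a2
      frechet_derivative_pd[OF smooth_on_differentiable[OF smooth_\<alpha> in_U[OF P]]]
    by (simp add: algebra_simps)
  then show ?thesis
    using section_pair[OF P N \<theta>, of u v] by (simp add: u v left_diff_distrib)
qed

text \<open>Ensures that the exterior derivative of the contact form is nonzero on the common
  kernel; the witnesses are D and
  \<open>\<partial>\<^sub>q + \<alpha> \<partial>\<^sub>p\<close>.\<close>

lemma kernel_pair_exists:
  obtains u v where "\<omega>\<^sub>0 P u = 0" "\<omega>\<^sub>1 P u = 0" "\<omega>\<^sub>0 P v = 0" "\<omega>\<^sub>1 P v = 0" "contact_pair u v = 1"
proof
  let ?u = "axis 2 1 + P $ 5 *\<^sub>R axis 3 1 :: jet" and ?v = "axis 5 1 + \<alpha> P *\<^sub>R axis 4 1 :: jet"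
  show "\<omega>\<^sub>0 P ?u = 0" "\<omega>\<^sub>1 P ?u = 0" "\<omega>\<^sub>0 P ?v = 0" "\<omega>\<^sub>1 P ?v = 0" "contact_pair ?u ?v = 1"
    by (simp_all add: contact_form_apply second_form_apply contact_pair_def axis_def)
qed

lemma section_pair_vanishes_iff:
  assumes P: "P \<in> V" and N: "open N" "\<pi> P \<in> N" and \<theta>: "smooth_on N \<theta>" "\<And>w. w \<in> N \<Longrightarrow> \<theta> w \<in> J w"
  shows "two_form_zero_mod (J (\<pi> P)) (ext_deriv (one_form \<theta>) (\<pi> P)) \<longleftrightarrow>
    coef 3 \<theta> P = T P * coef 4 \<theta> P"
proof -
  have "two_form_zero_mod (J (\<pi> P)) (ext_deriv (one_form \<theta>) (\<pi> P)) \<longleftrightarrow>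
    (\<forall>u\<in>common_kernel (J (\<pi> P)). \<forall>v\<in>common_kernel (J (\<pi> P)). ext_deriv_pair \<theta> (\<pi> P) u v = 0)"
    by (rule two_form_zero_mod_ext_deriv_iff[OF _ J_eq_span[OF in_W[OF P]] smooth_on_differentiable[OF \<theta>(1) N(2)]]) simp
  also have "\<dots> \<longleftrightarrow> coef 3 \<theta> P = T P * coef 4 \<theta> P"
  proof
    obtain u v where uv: "\<omega>\<^sub>0 P u = 0" "\<omega>\<^sub>1 P u = 0" "\<omega>\<^sub>0 P v = 0" "\<omega>\<^sub>1 P v = 0" "contact_pair u v = 1"
      using kernel_pair_exists .
    assume "\<forall>u\<in>common_kernel (J (\<pi> P)). \<forall>v\<in>common_kernel (J (\<pi> P)). ext_deriv_pair \<theta> (\<pi> P) u v = 0"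
    then have "ext_deriv_pair \<theta> (\<pi> P) (d\<pi> P u) (d\<pi> P v) = 0"
      using kernel_J_iff[OF P] uv by blast
    then show "coef 3 \<theta> P = T P * coef 4 \<theta> P"
      using section_pair_on_kernel[OF P N \<theta> uv(1-4)] uv(5) by simp
  next
    assume eq: "coef 3 \<theta> P = T P * coef 4 \<theta> P"
    show "\<forall>u\<in>common_kernel (J (\<pi> P)). \<forall>v\<in>common_kernel (J (\<pi> P)). ext_deriv_pair \<theta> (\<pi> P) u v = 0"
    proof (intro ballI)
      fix y z assume yz: "y \<in> common_kernel (J (\<pi> P))" "z \<in> common_kernel (J (\<pi> P))"
      obtain u v where uv: "y = d\<pi> P u" "z = d\<pi> P v" using lift_vector[OF P] by metis
      then show "ext_deriv_pair \<theta> (\<pi> P) y z = 0"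
        using section_pair_on_kernel[OF P N \<theta>, of u v] yz kernel_J_iff[OF P] eq by auto
    qed
  qed
  finally show ?thesis .
qed

section \<open>Fibres of the first derived system\<close>

text \<open>The linear equation on the coefficients singles out the covectors that pull back to
  multiples of \<omega>'. Each solution extends to a section with constant frame
  coefficients.\<close>

lemma derived_J:
  assumes "P \<in> V"
  shows "derived_system J (\<pi> P) = {\<mu> \<in> J (\<pi> P).
    blinfun_apply \<mu> (d\<pi> P (axis 3 1)) = T P * blinfun_apply \<mu> (d\<pi> P (axis 4 1))}"
proof safe
  fix \<mu> assume "\<mu> \<in> derived_system J (\<pi> P)"
  then obtain \<theta> N where *: "\<mu> = \<theta> (\<pi> P)" "open N" "\<pi> P \<in> N" "smooth_on N \<theta>" "\<forall>w\<in>N. \<theta> w \<in> J w"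
    "two_form_zero_mod (J (\<pi> P)) (ext_deriv (one_form \<theta>) (\<pi> P))"
    by (auto simp: derived_system_def)
  then show "\<mu> \<in> J (\<pi> P)" by auto
  show "blinfun_apply \<mu> (d\<pi> P (axis 3 1)) = T P * blinfun_apply \<mu> (d\<pi> P (axis 4 1))"
    using section_pair_vanishes_iff[OF assms *(2,3,4)] * by (auto simp: coef_def)
next
  fix \<mu> assume \<mu>: "\<mu> \<in> J (\<pi> P)"
    "blinfun_apply \<mu> (d\<pi> P (axis 3 1)) = T P * blinfun_apply \<mu> (d\<pi> P (axis 4 1))"
  obtain \<theta> where \<theta>: "smooth_on W \<theta>" "\<theta> (\<pi> P) = \<mu>" "\<And>w. w \<in> W \<Longrightarrow> \<theta> w \<in> J w"
    using smooth_frame_on_section[OF open_W smooth_frame in_W[OF assms] \<mu>(1)] by blast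
  show "\<mu> \<in> derived_system J (\<pi> P)"
    unfolding derived_system_def
    using section_pair_vanishes_iff[OF assms open_W in_W[OF assms] \<theta>(1,3)] \<theta> \<mu> open_W in_W[OF assms]
    by (auto simp: coef_def intro!: exI[of _ \<theta>] exI[of _ W])
qed

text \<open>The fibre contains a covector that pulls back to \<omega>' itself, and all its elements
  pull back to multiples of \<omega>'.\<close>

lemma kernel_derived_J_iff:
  assumes "P \<in> V"
  shows "d\<pi> P v \<in> common_kernel (derived_system J (\<pi> P)) \<longleftrightarrow> v \<in> derived_kernel \<alpha> P"
proof
  obtain \<nu> where \<nu>: "\<nu> \<in> J (\<pi> P)" "\<And>v. blinfun_apply \<nu> (d\<pi> P v) = T P * \<omega>\<^sub>0 P v + 1 * \<omega>\<^sub>1 P v"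
    using J_element_exists[OF assms, of "T P" 1] by blast
  have "\<nu> \<in> derived_system J (\<pi> P)"
    using \<nu> by (simp add: derived_J[OF assms] contact_form_apply second_form_apply axis_def)
  moreover assume "d\<pi> P v \<in> common_kernel (derived_system J (\<pi> P))"
  ultimately show "v \<in> derived_kernel \<alpha> P"
    using \<nu>(2)[of v] by (auto simp: common_kernel_def derived_kernel_def)
next
  assume v: "v \<in> derived_kernel \<alpha> P"
  show "d\<pi> P v \<in> common_kernel (derived_system J (\<pi> P))"
    unfolding common_kernel_def
  proof safe
    fix \<mu> assume "\<mu> \<in> derived_system J (\<pi> P)"
    then have "blinfun_apply \<mu> (d\<pi> P v) =
        blinfun_apply \<mu> (d\<pi> P (axis 4 1)) * (T P * \<omega>\<^sub>0 P v + \<omega>\<^sub>1 P v)"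
      using pullback_J[OF assms, of \<mu> v] by (auto simp: derived_J[OF assms] algebra_simps)
    then show "blinfun_apply \<mu> (d\<pi> P v) = 0" using v by (simp add: derived_kernel_def)
  qed
qed

text \<open>An element of the fibre is determined by its coefficient of
  \<open>\<omega>\<^sub>1\<close>, so any nonzero element spans.\<close>

lemma derived_J_eq_span:
  assumes "w \<in> W" "\<eta> \<in> derived_system J w" "\<eta> \<noteq> 0"
  shows "derived_system J w = span {\<eta>}"
proof -
  obtain P where P: "P \<in> V" "w = \<pi> P" using lift_point[OF assms(1)] .
  let ?b = "\<lambda>\<mu>. blinfun_apply \<mu> (d\<pi> P (axis 4 1))"
  have pb: "blinfun_apply \<mu> (d\<pi> P v) = ?b \<mu> * (T P * \<omega>\<^sub>0 P v + \<omega>\<^sub>1 P v)"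
    if "\<mu> \<in> derived_system J w" for \<mu> v
    using that pullback_J[OF P(1), of \<mu> v] by (auto simp: P(2) derived_J[OF P(1)] algebra_simps)
  have "?b \<eta> \<noteq> 0"
  proof
    assume 0: "?b \<eta> = 0"
    have "blinfun_apply \<eta> (d\<pi> P v) = blinfun_apply 0 (d\<pi> P v)" for v
      unfolding pb[OF assms(2), of v] 0 by simp
    from pullback_determines[OF P(1) this] show False using assms(3) by simp
  qed
  have "\<mu> = (?b \<mu> / ?b \<eta>) *\<^sub>R \<eta>" if "\<mu> \<in> derived_system J w" for \<mu>
  proof (rule pullback_determines[OF P(1)])
    fix v
    show "blinfun_apply \<mu> (d\<pi> P v) = blinfun_apply ((?b \<mu> / ?b \<eta>) *\<^sub>R \<eta>) (d\<pi> P v)"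
      unfolding blinfun.scaleR_left pb[OF that, of v] pb[OF assms(2), of v] using \<open>?b \<eta> \<noteq> 0\<close> by simp
  qed
  moreover have "c *\<^sub>R \<eta> \<in> derived_system J w" for c
    using assms(2) subspace_scale[OF subspace_J[OF assms(1)]]
    by (auto simp: P(2) derived_J[OF P(1)] blinfun.scaleR_left)
  ultimately show ?thesis by (force simp: span_singleton)
qed

end

section \<open>The second derived system\<close>

lemma derived_system_subset: "derived_system J m \<subseteq> J m"
  by (auto simp: derived_system_def)

lemma open_nonzero_set:
  fixes c :: "'a::euclidean_space \<Rightarrow> real"
  assumes "open M" "smooth_on M c"
  shows "open {w \<in> M. c w \<noteq> 0}"
proof -
  have "{w \<in> M. c w \<noteq> 0} = M \<inter> c -` (- {0})" by auto
  then show ?thesis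
    using continuous_open_preimage[OF smooth_on_continuous_on[OF assms(2)] assms(1), of "- {0}"]
    by (simp add: open_Compl)
qed

context jet_reduction
begin

section \<open>Sections and frames of the first derived system\<close>

text \<open>The pullback of \<theta> is b \<omega>' with b = \<open>coef 4 \<theta>\<close>. On the
  kernel of \<omega>' the product of db and \<omega>' vanishes, which leaves b d\<omega>'.\<close>

lemma derived_section_pair:
  assumes P: "P \<in> V" and N: "open N" "\<pi> P \<in> N" and \<theta>: "smooth_on N \<theta>"
    "\<And>w. w \<in> N \<Longrightarrow> \<theta> w \<in> derived_system J w"
    and uv: "u \<in> derived_kernel \<alpha> P" "v \<in> derived_kernel \<alpha> P"
  shows "ext_deriv_pair \<theta> (\<pi> P) (d\<pi> P u) (d\<pi> P v) = coef 4 \<theta> P * derived_pair \<alpha> P u v"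
proof -
  have \<theta>J: "\<And>w. w \<in> N \<Longrightarrow> \<theta> w \<in> J w" using \<theta>(2) derived_system_subset by blast
  define M where "M = V \<inter> \<pi> -` N"
  have M: "open M" "P \<in> M"
    using continuous_open_preimage[OF smooth_on_continuous_on[OF smooth_\<pi>] open_V N(1)] P N(2)
    by (auto simp: M_def)
  \<comment> \<open>This relation holds on a whole neighbourhood of \<open>P\<close>, so it can be
    differentiated.\<close>
  have eq: "coef 3 \<theta> R = T R * coef 4 \<theta> R" if "R \<in> M" for R
    using that \<theta>(2)[of "\<pi> R"] by (auto simp: M_def derived_J coef_def)
  note c = coef_differentiable[OF P smooth_on_differentiable[OF \<theta>(1) N(2)], unfolded frechet_derivative_works]
  note dT = smooth_on_has_derivative[OF smooth_on_total_y[OF open_U smooth_\<alpha>] in_U[OF P]]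
  have "(coef 3 \<theta> has_derivative (\<lambda>u. T P * frechet_derivative (coef 4 \<theta>) (at P) u +
      frechet_derivative T (at P) u * coef 4 \<theta> P)) (at P)"
    by (rule has_derivative_transform_within_open[OF has_derivative_mult[OF dT c] M]) (simp add: eq)
  note d3 = frechet_derivative_at[OF this, symmetric]
  have w: "\<omega>\<^sub>1 P u = - T P * \<omega>\<^sub>0 P u" "\<omega>\<^sub>1 P v = - T P * \<omega>\<^sub>0 P v"
    using uv by (auto simp: derived_kernel_def)
  show ?thesis
    using section_pair[OF P N \<theta>(1) \<theta>J, of u v]
    by (simp add: d3 w eq[OF M(2)] derived_pair_def algebra_simps)
qed

lemma derived_J_coef_zero:
  assumes "P \<in> V" "\<mu> \<in> derived_system J (\<pi> P)"
  shows "blinfun_apply \<mu> (d\<pi> P (axis 4 1)) = 0 \<longleftrightarrow> \<mu> = 0"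
proof
  assume 0: "blinfun_apply \<mu> (d\<pi> P (axis 4 1)) = 0"
  then have 1: "\<mu> \<in> J (\<pi> P)" "blinfun_apply \<mu> (d\<pi> P (axis 3 1)) = 0"
    using assms by (auto simp: derived_J)
  have "blinfun_apply \<mu> (d\<pi> P v) = blinfun_apply 0 (d\<pi> P v)" for v
    unfolding pullback_J[OF assms(1) 1(1), of v] 0 1(2) by simp
  from pullback_determines[OF assms(1) this] show "\<mu> = 0" .
qed simp

lemma scale_in_derived_J:
  assumes "w \<in> W" "\<mu> \<in> derived_system J w"
  shows "c *\<^sub>R \<mu> \<in> derived_system J w"
proof -
  obtain P where P: "P \<in> V" "w = \<pi> P" using lift_point[OF assms(1)] .
  show ?thesis
    using assms(2) subspace_scale[OF subspace_J[OF in_W[OF P(1)]]]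
    unfolding P(2) derived_J[OF P(1)] by (simp add: blinfun.scaleR_left)
qed

text \<open>If \<open>\<theta>\<^sub>1, \<theta>\<^sub>2\<close> frame \<open>J\<close> and \<open>F, G\<close> lie in its kernel, then \<open>d\<theta>\<^sub>2(F, G) \<theta>\<^sub>1 - d\<theta>\<^sub>1(F, G) \<theta>\<^sub>2\<close> is a
  section of the derived system. The fields \<open>F, G\<close> are constant vectors projected to the kernel by
  Cramer's rule, without its denominator.\<close>

lemma derived_frame:
  assumes "w\<^sub>0 \<in> W"
  obtains N \<eta> where "open N" "w\<^sub>0 \<in> N" "N \<subseteq> W" "smooth_on N \<eta>"
    "\<And>w. w \<in> N \<Longrightarrow> \<eta> w \<in> derived_system J w" "\<And>w. w \<in> N \<Longrightarrow> \<eta> w \<noteq> 0"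
proof -
  obtain P\<^sub>0 where P0: "P\<^sub>0 \<in> V" "w\<^sub>0 = \<pi> P\<^sub>0" using lift_point[OF assms] .
  \<comment> \<open>Prescribing the pullbacks \<open>\<omega>\<^sub>0\<close> and
    \<open>\<omega>\<^sub>1\<close> at the base point normalises all later quantities there.\<close>
  obtain \<mu>\<^sub>1 where \<mu>1: "\<mu>\<^sub>1 \<in> J w\<^sub>0" "\<And>v. blinfun_apply \<mu>\<^sub>1 (d\<pi> P\<^sub>0 v) = \<omega>\<^sub>0 P\<^sub>0 v"
    using J_element_exists[OF P0(1), of 1 0] P0(2) by auto
  obtain \<mu>\<^sub>2 where \<mu>2: "\<mu>\<^sub>2 \<in> J w\<^sub>0" "\<And>v. blinfun_apply \<mu>\<^sub>2 (d\<pi> P\<^sub>0 v) = \<omega>\<^sub>1 P\<^sub>0 v"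
    using J_element_exists[OF P0(1), of 0 1] P0(2) by auto
  obtain \<theta>\<^sub>1 where \<theta>1: "smooth_on W \<theta>\<^sub>1" "\<theta>\<^sub>1 w\<^sub>0 = \<mu>\<^sub>1" "\<And>w. w \<in> W \<Longrightarrow> \<theta>\<^sub>1 w \<in> J w"
    using smooth_frame_on_section[OF open_W smooth_frame assms \<mu>1(1)] by blast
  obtain \<theta>\<^sub>2 where \<theta>2: "smooth_on W \<theta>\<^sub>2" "\<theta>\<^sub>2 w\<^sub>0 = \<mu>\<^sub>2" "\<And>w. w \<in> W \<Longrightarrow> \<theta>\<^sub>2 w \<in> J w"
    using smooth_frame_on_section[OF open_W smooth_frame assms \<mu>2(1)] by blast
  obtain u v where uv: "\<omega>\<^sub>0 P\<^sub>0 u = 0" "\<omega>\<^sub>1 P\<^sub>0 u = 0" "\<omega>\<^sub>0 P\<^sub>0 v = 0" "\<omega>\<^sub>1 P\<^sub>0 v = 0" "contact_pair u v = 1"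
    using kernel_pair_exists .
  define x where "x = d\<pi> P\<^sub>0 (axis 3 1)"
  define y where "y = d\<pi> P\<^sub>0 (axis 4 1)"
  \<comment> \<open>The Cramer determinant, equal to 1 at the base point. Where it is nonzero,
    \<open>pr f\<close> is \<open>g\<close> times the projection of \<open>f\<close> along
    \<open>x\<close> and \<open>y\<close> onto the common kernel of the two sections.\<close>
  define g where "g w = \<theta>\<^sub>1 w x * \<theta>\<^sub>2 w y - \<theta>\<^sub>1 w y * \<theta>\<^sub>2 w x" for w
  define pr where "pr f w = g w *\<^sub>R f - (\<theta>\<^sub>1 w f * \<theta>\<^sub>2 w y - \<theta>\<^sub>1 w y * \<theta>\<^sub>2 w f) *\<^sub>R x -
    (\<theta>\<^sub>1 w x * \<theta>\<^sub>2 w f - \<theta>\<^sub>1 w f * \<theta>\<^sub>2 w x) *\<^sub>R y" for f w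
  define F where "F = pr (d\<pi> P\<^sub>0 u)"
  define G where "G = pr (d\<pi> P\<^sub>0 v)"
  have pr0: "\<theta>\<^sub>1 w (pr f w) = 0" "\<theta>\<^sub>2 w (pr f w) = 0" for f w
    unfolding pr_def g_def blinfun.diff_right blinfun.scaleR_right real_scaleR_def
    by (simp_all add: algebra_simps)
  define c\<^sub>1 where "c\<^sub>1 w = ext_deriv_pair \<theta>\<^sub>1 w (F w) (G w)" for w
  define c\<^sub>2 where "c\<^sub>2 w = ext_deriv_pair \<theta>\<^sub>2 w (F w) (G w)" for w
  have sm: "smooth_on W (\<lambda>w. \<theta>\<^sub>1 w f)" "smooth_on W (\<lambda>w. \<theta>\<^sub>2 w f)" for f
    by (intro smooth_on_blinfun_apply open_W \<theta>1 \<theta>2 smooth_on_const)+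
  have smg: "smooth_on W g"
    unfolding g_def[abs_def] by (intro smooth_on_diff smooth_on_mult open_W sm)
  have smpr: "smooth_on W (pr f)" for f
    unfolding pr_def[abs_def]
    by (intro smooth_on_diff smooth_on_scaleR smooth_on_mult smooth_on_const open_W sm smg)
  have smc: "smooth_on W c\<^sub>1" "smooth_on W c\<^sub>2"
    unfolding c\<^sub>1_def[abs_def] c\<^sub>2_def[abs_def] F_def G_def
    by (intro smooth_on_ext_deriv_pair open_W \<theta>1 \<theta>2 smpr)+
  \<comment> \<open>Nonzero \<open>g\<close> makes the two sections independent, and nonzero
    \<open>c\<^sub>1\<close> then makes their combination \<eta> nonzero.\<close>
  define N where "N = {w \<in> W. c\<^sub>1 w \<noteq> 0} \<inter> {w \<in> W. g w \<noteq> 0}"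
  define \<eta> where "\<eta> w = c\<^sub>2 w *\<^sub>R \<theta>\<^sub>1 w - c\<^sub>1 w *\<^sub>R \<theta>\<^sub>2 w" for w
  have N: "open N" "N \<subseteq> W"
    unfolding N_def using open_nonzero_set[OF open_W] smc smg by (auto intro: open_Int)
  have at0: "\<theta>\<^sub>1 w\<^sub>0 (d\<pi> P\<^sub>0 s) = \<omega>\<^sub>0 P\<^sub>0 s" "\<theta>\<^sub>2 w\<^sub>0 (d\<pi> P\<^sub>0 s) = \<omega>\<^sub>1 P\<^sub>0 s" for s
    by (simp_all add: \<theta>1 \<theta>2 \<mu>1 \<mu>2)
  have ax: "\<omega>\<^sub>0 P\<^sub>0 (axis 3 1) = 1" "\<omega>\<^sub>0 P\<^sub>0 (axis 4 1) = 0" "\<omega>\<^sub>1 P\<^sub>0 (axis 3 1) = 0" "\<omega>\<^sub>1 P\<^sub>0 (axis 4 1) = 1"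
    by (simp_all add: contact_form_apply second_form_apply axis_def)
  have g0: "g w\<^sub>0 = 1" by (simp add: g_def x_def y_def at0 ax)
  have FG0: "F w\<^sub>0 = d\<pi> P\<^sub>0 u" "G w\<^sub>0 = d\<pi> P\<^sub>0 v"
    by (simp_all add: F_def G_def pr_def g0 at0 uv)
  have coef0: "coef 3 \<theta>\<^sub>1 P\<^sub>0 = 1" "coef 4 \<theta>\<^sub>1 P\<^sub>0 = 0"
    by (simp_all add: coef_def at0 ax flip: P0(2))
  have "c\<^sub>1 w\<^sub>0 = 1"
    using section_pair_on_kernel[OF P0(1) open_W in_W[OF P0(1)] \<theta>1(1,3) uv(1-4)] uv(5)
    by (simp add: c\<^sub>1_def FG0 coef0 P0(2)[symmetric])
  then have w0: "w\<^sub>0 \<in> N" using g0 assms by (simp add: N_def)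
  have "smooth_on N \<eta>"
    unfolding \<eta>_def[abs_def]
    by (intro smooth_on_subset[OF _ N(2)] smooth_on_diff smooth_on_scaleR open_W smc \<theta>1 \<theta>2)
  moreover have "\<eta> w \<in> derived_system J w \<and> \<eta> w \<noteq> 0" if "w \<in> N" for w
  proof -
    have w: "w \<in> W" "c\<^sub>1 w \<noteq> 0" "g w \<noteq> 0" using that by (auto simp: N_def)
    obtain P where P: "P \<in> V" "w = \<pi> P" using lift_point[OF w(1)] .
    obtain u' v' where lift: "F w = d\<pi> P u'" "G w = d\<pi> P v'" using lift_vector[OF P(1)] by metis
    obtain x' y' where lift': "x = d\<pi> P x'" "y = d\<pi> P y'" using lift_vector[OF P(1)] by metis
    define a\<^sub>1 b\<^sub>1 a\<^sub>2 b\<^sub>2 where ab: "a\<^sub>1 = coef 3 \<theta>\<^sub>1 P" "b\<^sub>1 = coef 4 \<theta>\<^sub>1 P" "a\<^sub>2 = coef 3 \<theta>\<^sub>2 P" "b\<^sub>2 = coef 4 \<theta>\<^sub>2 P"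
    have pb: "\<theta>\<^sub>1 w (d\<pi> P s) = a\<^sub>1 * \<omega>\<^sub>0 P s + b\<^sub>1 * \<omega>\<^sub>1 P s" "\<theta>\<^sub>2 w (d\<pi> P s) = a\<^sub>2 * \<omega>\<^sub>0 P s + b\<^sub>2 * \<omega>\<^sub>1 P s" for s
      using pullback_J[OF P(1), of "\<theta>\<^sub>1 w" s] pullback_J[OF P(1), of "\<theta>\<^sub>2 w" s] \<theta>1(3)[OF w(1)] \<theta>2(3)[OF w(1)]
      by (simp_all add: ab coef_def P(2))
    have "g w = (a\<^sub>1 * b\<^sub>2 - a\<^sub>2 * b\<^sub>1) * (\<omega>\<^sub>0 P x' * \<omega>\<^sub>1 P y' - \<omega>\<^sub>0 P y' * \<omega>\<^sub>1 P x')"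
      unfolding g_def lift' pb by (simp add: algebra_simps)
    then have det: "a\<^sub>1 * b\<^sub>2 - a\<^sub>2 * b\<^sub>1 \<noteq> 0" using w(3) by auto
    have ker: "\<omega>\<^sub>0 P s = 0" "\<omega>\<^sub>1 P s = 0"
      if "a\<^sub>1 * \<omega>\<^sub>0 P s + b\<^sub>1 * \<omega>\<^sub>1 P s = 0" "a\<^sub>2 * \<omega>\<^sub>0 P s + b\<^sub>2 * \<omega>\<^sub>1 P s = 0" for s
    proof -
      have "(a\<^sub>1 * b\<^sub>2 - a\<^sub>2 * b\<^sub>1) * \<omega>\<^sub>0 P s = 0" "(a\<^sub>1 * b\<^sub>2 - a\<^sub>2 * b\<^sub>1) * \<omega>\<^sub>1 P s = 0"
        using that by algebra+
      then show "\<omega>\<^sub>0 P s = 0" "\<omega>\<^sub>1 P s = 0" using det by auto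
    qed
    have z: "\<theta>\<^sub>1 w (d\<pi> P u') = 0" "\<theta>\<^sub>2 w (d\<pi> P u') = 0" "\<theta>\<^sub>1 w (d\<pi> P v') = 0" "\<theta>\<^sub>2 w (d\<pi> P v') = 0"
      unfolding lift[symmetric] F_def G_def by (rule pr0)+
    note u' = ker[OF z(1,2)[unfolded pb]] and v' = ker[OF z(3,4)[unfolded pb]]
    \<comment> \<open>Both values share the factor \<open>contact_pair u' v'\<close>, so the
      differences a - T b cancel in \<open>\<eta> w\<close>; this is the equation in
      \<open>derived_J\<close>.\<close>
    have c: "c\<^sub>1 w = (a\<^sub>1 - T P * b\<^sub>1) * contact_pair u' v'" "c\<^sub>2 w = (a\<^sub>2 - T P * b\<^sub>2) * contact_pair u' v'"
      using section_pair_on_kernel[OF P(1) open_W in_W[OF P(1)] \<theta>1(1,3) u' v']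
        section_pair_on_kernel[OF P(1) open_W in_W[OF P(1)] \<theta>2(1,3) u' v']
      by (simp_all add: c\<^sub>1_def c\<^sub>2_def lift ab P(2)[symmetric])
    have "\<eta> w \<in> J w"
      unfolding \<eta>_def using subspace_J[OF w(1)] \<theta>1(3)[OF w(1)] \<theta>2(3)[OF w(1)]
      by (intro subspace_diff subspace_scale)
    moreover have "blinfun_apply (\<eta> w) (d\<pi> P (axis 3 1)) = T P * blinfun_apply (\<eta> w) (d\<pi> P (axis 4 1))"
    proof -
      have "\<theta>\<^sub>1 w (d\<pi> P (axis 3 1)) = a\<^sub>1" "\<theta>\<^sub>1 w (d\<pi> P (axis 4 1)) = b\<^sub>1"
        "\<theta>\<^sub>2 w (d\<pi> P (axis 3 1)) = a\<^sub>2" "\<theta>\<^sub>2 w (d\<pi> P (axis 4 1)) = b\<^sub>2"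
        by (simp_all add: ab coef_def P(2))
      then show ?thesis
        unfolding \<eta>_def blinfun.diff_left blinfun.scaleR_left by (simp add: c algebra_simps)
    qed
    ultimately have "\<eta> w \<in> derived_system J w" using derived_J[OF P(1)] P(2) by simp
    moreover have "\<eta> w \<noteq> 0"
    proof
      assume "\<eta> w = 0"
      then have "c\<^sub>2 w * \<theta>\<^sub>1 w s = c\<^sub>1 w * \<theta>\<^sub>2 w s" for s
        by (metis \<eta>_def blinfun.diff_left blinfun.scaleR_left blinfun.zero_left eq_iff_diff_eq_0 real_scaleR_def)
      from this[of x] this[of y] have "c\<^sub>1 w * g w = 0" unfolding g_def by algebra
      then show False using w by simp
    qed
    ultimately show ?thesis ..
  qed
  ultimately show ?thesis using that N w0 by blast
qed

lemma subbundle_near_derived_J: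
  assumes "w \<in> W" shows "subbundle_near (derived_system J) w"
proof -
  obtain N \<eta> where N: "open N" "w \<in> N" "N \<subseteq> W" and \<eta>: "smooth_on N \<eta>"
    "\<And>w. w \<in> N \<Longrightarrow> \<eta> w \<in> derived_system J w" "\<And>w. w \<in> N \<Longrightarrow> \<eta> w \<noteq> 0"
    using derived_frame[OF assms] by blast
  have "derived_system J z = span {\<eta> z}" if "z \<in> N" for z
    using derived_J_eq_span \<eta>(2,3) N(3) that by blast
  then have "smooth_frame_on N [\<eta>] (derived_system J)"
    using \<eta>(1,3) by (simp add: smooth_frame_on_def)
  then show ?thesis
    unfolding subbundle_near_def using N(1,2) by blast
qed

section \<open>The second derived system and the star condition\<close>

text \<open>On the jet space the test becomes \<open>coef 4 \<theta> P\<close> times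
  \<open>derived_pair\<close>; the first factor vanishes only with
  \<open>\<theta> (\<pi> P)\<close>, and the second is governed by the star condition.\<close>

lemma second_derived_section_iff:
  assumes P: "P \<in> V" and N: "open N" "\<pi> P \<in> N" and \<theta>: "smooth_on N \<theta>"
    "\<And>w. w \<in> N \<Longrightarrow> \<theta> w \<in> derived_system J w"
  shows "two_form_zero_mod (derived_system J (\<pi> P)) (ext_deriv (one_form \<theta>) (\<pi> P)) \<longleftrightarrow>
    \<theta> (\<pi> P) = 0 \<or> star_condition \<alpha> P"
proof -
  obtain \<nu> where \<nu>: "\<nu> \<in> derived_system J (\<pi> P)" "\<nu> \<noteq> 0"
    using derived_frame[OF in_W[OF P]] by metis
  have "two_form_zero_mod (derived_system J (\<pi> P)) (ext_deriv (one_form \<theta>) (\<pi> P)) \<longleftrightarrow>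
    (\<forall>u\<in>common_kernel (derived_system J (\<pi> P)). \<forall>v\<in>common_kernel (derived_system J (\<pi> P)).
      ext_deriv_pair \<theta> (\<pi> P) u v = 0)"
    by (rule two_form_zero_mod_ext_deriv_iff[OF _ derived_J_eq_span[OF in_W[OF P] \<nu>]
          smooth_on_differentiable[OF \<theta>(1) N(2)]]) simp
  also have "\<dots> \<longleftrightarrow> (\<forall>u\<in>derived_kernel \<alpha> P. \<forall>v\<in>derived_kernel \<alpha> P.
      ext_deriv_pair \<theta> (\<pi> P) (d\<pi> P u) (d\<pi> P v) = 0)"
    using kernel_derived_J_iff[OF P] lift_vector[OF P] by metis
  also have "\<dots> \<longleftrightarrow> coef 4 \<theta> P = 0 \<or>
      (\<forall>u\<in>derived_kernel \<alpha> P. \<forall>v\<in>derived_kernel \<alpha> P. derived_pair \<alpha> P u v = 0)"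
    using derived_section_pair[OF P N \<theta>] by auto
  also have "\<dots> \<longleftrightarrow> \<theta> (\<pi> P) = 0 \<or> star_condition \<alpha> P"
    unfolding coef_def derived_J_coef_zero[OF P \<theta>(2)[OF N(2)]]
      derived_pair_vanishes_iff[OF open_U smooth_\<alpha> involutive in_U[OF P]] ..
  finally show ?thesis .
qed

lemma second_derived_J:
  assumes "P \<in> V"
  shows "derived_system (derived_system J) (\<pi> P) =
    (if star_condition \<alpha> P then derived_system J (\<pi> P) else {0})"
proof -
  have sub: "\<mu> = 0 \<or> star_condition \<alpha> P"
    if \<mu>: "\<mu> \<in> derived_system (derived_system J) (\<pi> P)" for \<mu>
  proof -
    obtain \<theta> N where "\<mu> = \<theta> (\<pi> P)" "open N" "\<pi> P \<in> N" "smooth_on N \<theta>"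
      "\<And>w. w \<in> N \<Longrightarrow> \<theta> w \<in> derived_system J w"
      "two_form_zero_mod (derived_system J (\<pi> P)) (ext_deriv (one_form \<theta>) (\<pi> P))"
      using \<mu> unfolding derived_system_def[of "derived_system J"] by blast
    then show ?thesis using second_derived_section_iff[OF assms, of N \<theta>] by blast
  qed
  obtain N \<eta> where N: "open N" "\<pi> P \<in> N" "N \<subseteq> W" and \<eta>: "smooth_on N \<eta>"
    "\<And>w. w \<in> N \<Longrightarrow> \<eta> w \<in> derived_system J w" "\<And>w. w \<in> N \<Longrightarrow> \<eta> w \<noteq> 0"
    using derived_frame[OF in_W[OF assms]] by blast
  \<comment> \<open>Constant multiples of \<eta> run through every element of the line;
    \<open>c = 0\<close> provides the zero element when the condition fails.\<close>
  have super: "c *\<^sub>R \<eta> (\<pi> P) \<in> derived_system (derived_system J) (\<pi> P)"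
    if "c = 0 \<or> star_condition \<alpha> P" for c
  proof -
    have sec: "c *\<^sub>R \<eta> w \<in> derived_system J w" if "w \<in> N" for w
      using scale_in_derived_J \<eta>(2) N(3) that by blast
    have sm: "smooth_on N (\<lambda>w. c *\<^sub>R \<eta> w)" by (intro smooth_on_scaleR smooth_on_const N \<eta>)
    show ?thesis
      unfolding derived_system_def[of "derived_system J"]
      using second_derived_section_iff[OF assms N(1,2) sm sec] sec sm that N(1,2)
      by (auto intro!: exI[of _ "\<lambda>w. c *\<^sub>R \<eta> w"] exI[of _ N])
  qed
  have span: "derived_system J (\<pi> P) = range (\<lambda>c. c *\<^sub>R \<eta> (\<pi> P))"
    using derived_J_eq_span[OF in_W[OF assms] \<eta>(2,3)[OF N(2)]] by (simp add: span_singleton)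
  show ?thesis
    using sub super[of 0] super derived_system_subset[of "derived_system J" "\<pi> P"] span by auto
qed

text \<open>A derived type asks for a subbundle near the point, so failure of the star condition has
  to spread over a neighbourhood in \<open>W\<close>. It is detected there by a smooth function:
  d\<eta> on two fields in the kernel of \<eta>.\<close>

lemma second_derived_J_zero_nearby:
  assumes P0: "P\<^sub>0 \<in> V" and "\<not> star_condition \<alpha> P\<^sub>0"
  obtains N where "open N" "\<pi> P\<^sub>0 \<in> N" "\<And>w. w \<in> N \<Longrightarrow> derived_system (derived_system J) w = {0}"
proof -
  let ?w = "\<pi> P\<^sub>0"
  obtain M \<eta> where M: "open M" "?w \<in> M" "M \<subseteq> W" and \<eta>: "smooth_on M \<eta>"
    "\<And>w. w \<in> M \<Longrightarrow> \<eta> w \<in> derived_system J w" "\<And>w. w \<in> M \<Longrightarrow> \<eta> w \<noteq> 0"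
    using derived_frame[OF in_W[OF P0]] by blast
  obtain u v where uv: "u \<in> derived_kernel \<alpha> P\<^sub>0" "v \<in> derived_kernel \<alpha> P\<^sub>0" "derived_pair \<alpha> P\<^sub>0 u v \<noteq> 0"
    using assms(2) derived_pair_vanishes_iff[OF open_U smooth_\<alpha> involutive in_U[OF P0]] by blast
  define x where "x = d\<pi> P\<^sub>0 (axis 4 1)"
  have x: "\<eta> ?w x \<noteq> 0"
    using derived_J_coef_zero[OF P0 \<eta>(2)[OF M(2)]] \<eta>(3)[OF M(2)] by (simp add: x_def)
  \<comment> \<open>Projection along \<open>x\<close> onto the kernel of \<open>\<eta> w\<close>,
    multiplied by \<open>\<eta> w x\<close> to avoid a division.\<close>
  define pr where "pr f w = \<eta> w x *\<^sub>R f - \<eta> w f *\<^sub>R x" for f w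
  define c where "c w = ext_deriv_pair \<eta> w (pr (d\<pi> P\<^sub>0 u) w) (pr (d\<pi> P\<^sub>0 v) w)" for w
  have smpr: "smooth_on M (pr f)" for f
    unfolding pr_def[abs_def]
    by (intro smooth_on_diff smooth_on_scaleR smooth_on_blinfun_apply smooth_on_const M \<eta>)
  have smc: "smooth_on M c"
    unfolding c_def[abs_def] by (intro smooth_on_ext_deriv_pair M \<eta> smpr)
  have ker: "pr f w \<in> common_kernel (derived_system J w)" if "w \<in> M" for f w
    unfolding derived_J_eq_span[OF subsetD[OF M(3) that] \<eta>(2,3)[OF that]] common_kernel_span
    by (simp add: common_kernel_def pr_def blinfun.diff_right blinfun.scaleR_right)
  have pr0: "pr (d\<pi> P\<^sub>0 s) ?w = d\<pi> P\<^sub>0 (\<eta> ?w x *\<^sub>R s)" if "s \<in> derived_kernel \<alpha> P\<^sub>0" for s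
  proof -
    have "\<eta> ?w (d\<pi> P\<^sub>0 s) = 0"
      using kernel_derived_J_iff[OF P0] that \<eta>(2)[OF M(2)] by (auto simp: common_kernel_def)
    then show ?thesis by (simp add: pr_def linear_cmul[OF linear_d\<pi>[OF P0]])
  qed
  have "c ?w = (\<eta> ?w x)\<^sup>2 * ext_deriv_pair \<eta> ?w (d\<pi> P\<^sub>0 u) (d\<pi> P\<^sub>0 v)"
    using linear_frechet_derivative[OF smooth_on_differentiable[OF \<eta>(1) M(2)]] uv
    by (simp add: c_def pr0 linear_cmul[OF linear_d\<pi>[OF P0]] ext_deriv_pair_def linear_cmul
        blinfun.scaleR_left blinfun.scaleR_right power2_eq_square algebra_simps)
  also have "\<dots> = (\<eta> ?w x)\<^sup>2 * (\<eta> ?w x * derived_pair \<alpha> P\<^sub>0 u v)"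
    using derived_section_pair[OF P0 M(1,2) \<eta>(1,2) uv(1,2)] by (simp add: coef_def x_def)
  finally have c0: "c ?w \<noteq> 0" using x uv(3) by simp
  have "derived_system (derived_system J) w = {0}" if "w \<in> {w \<in> M. c w \<noteq> 0}" for w
  proof -
    have w: "w \<in> M" "c w \<noteq> 0" using that by auto
    obtain P where P: "P \<in> V" "w = \<pi> P" using lift_point w(1) M(3) by blast
    obtain u' v' where lift: "pr (d\<pi> P\<^sub>0 u) w = d\<pi> P u'" "pr (d\<pi> P\<^sub>0 v) w = d\<pi> P v'"
      using lift_vector[OF P(1)] by metis
    then have "u' \<in> derived_kernel \<alpha> P" "v' \<in> derived_kernel \<alpha> P"
      using ker[OF w(1)] kernel_derived_J_iff[OF P(1)] P(2) by metis+
    moreover from this have "derived_pair \<alpha> P u' v' \<noteq> 0"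
      using w(2) derived_section_pair[OF P(1) M(1) _ \<eta>(1,2), of u' v'] w(1) lift P(2)
      by (auto simp: c_def)
    ultimately have "\<not> star_condition \<alpha> P"
      using derived_pair_vanishes_iff[OF open_U smooth_\<alpha> involutive in_U[OF P(1)]] by blast
    then show ?thesis using second_derived_J[OF P(1)] P(2) by simp
  qed
  then show ?thesis using that[OF open_nonzero_set[OF M(1) smc]] M(2) c0 by blast
qed

section \<open>Ranks and the derived type\<close>

text \<open>The length of the frame is left open by \<open>reduction\<close>; the rank comes from
  the two covectors that pull back to \<open>\<omega>\<^sub>0\<close> and
  \<open>\<omega>\<^sub>1\<close>, which form a basis.\<close>

lemma dim_J:
  assumes "w \<in> W" shows "dim (J w) = 2"
proof -
  obtain P where P: "P \<in> V" "w = \<pi> P" using lift_point[OF assms] .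
  obtain \<mu> where \<mu>: "\<mu> \<in> J w" "\<And>v. blinfun_apply \<mu> (d\<pi> P v) = \<omega>\<^sub>0 P v"
    using J_element_exists[OF P(1), of 1 0] P(2) by auto
  obtain \<nu> where \<nu>: "\<nu> \<in> J w" "\<And>v. blinfun_apply \<nu> (d\<pi> P v) = \<omega>\<^sub>1 P v"
    using J_element_exists[OF P(1), of 0 1] P(2) by auto
  have ax: "\<omega>\<^sub>0 P (axis 3 1) = 1" "\<omega>\<^sub>0 P (axis 4 1) = 0" "\<omega>\<^sub>1 P (axis 3 1) = 0" "\<omega>\<^sub>1 P (axis 4 1) = 1"
    by (simp_all add: contact_form_apply second_form_apply axis_def)
  have "\<mu> \<notin> span {\<nu>}"
  proof
    assume "\<mu> \<in> span {\<nu>}"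
    then obtain k where "\<mu> = k *\<^sub>R \<nu>" by (auto simp: span_singleton)
    then have "\<omega>\<^sub>0 P (axis 3 1) = k * \<omega>\<^sub>1 P (axis 3 1)"
      by (metis \<mu>(2) \<nu>(2) blinfun.scaleR_left real_scaleR_def)
    then show False by (simp add: ax)
  qed
  moreover have "\<nu> \<noteq> 0" using \<nu>(2)[of "axis 4 1"] ax by auto
  ultimately have ind: "independent {\<mu>, \<nu>}" and ne: "\<mu> \<noteq> \<nu>"
    by (auto simp: independent_insert span_base)
  have "J w \<subseteq> span {\<mu>, \<nu>}"
  proof
    fix \<kappa> assume "\<kappa> \<in> J w"
    then have \<kappa>: "\<kappa> \<in> J (\<pi> P)" by (simp add: P(2))
    have "\<kappa> = \<kappa> (d\<pi> P (axis 3 1)) *\<^sub>R \<mu> + \<kappa> (d\<pi> P (axis 4 1)) *\<^sub>R \<nu>"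
    proof (rule pullback_determines[OF P(1)])
      fix v
      show "\<kappa> (d\<pi> P v) = (\<kappa> (d\<pi> P (axis 3 1)) *\<^sub>R \<mu> + \<kappa> (d\<pi> P (axis 4 1)) *\<^sub>R \<nu>) (d\<pi> P v)"
        unfolding pullback_J[OF P(1) \<kappa>, of v] by (simp add: blinfun.add_left blinfun.scaleR_left \<mu>(2) \<nu>(2))
    qed
    then show "\<kappa> \<in> span {\<mu>, \<nu>}"
      by (rule ssubst) (intro span_add span_scale span_base; simp)
  qed
  then have "J w = span {\<mu>, \<nu>}"
    using \<mu>(1) \<nu>(1) subspace_J[OF assms] by (simp add: span_minimal subset_antisym)
  then show ?thesis using dim_span_eq_card_independent[OF ind] ne by simp
qed

lemma dim_derived_J:
  assumes "w \<in> W" shows "dim (derived_system J w) = 1"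
proof -
  obtain \<nu> where \<nu>: "\<nu> \<in> derived_system J w" "\<nu> \<noteq> 0"
    using derived_frame[OF assms] by metis
  have "independent {\<nu>}" using \<nu>(2) by simp
  then show ?thesis
    unfolding derived_J_eq_span[OF assms \<nu>] by (simp add: dim_span_eq_card_independent del: dim_span)
qed

lemma derived_type:
  assumes "P \<in> V"
  shows "(derived_type_at J (\<pi> P) [2, 3] \<longleftrightarrow> star_condition \<alpha> P) \<and>
    (derived_type_at J (\<pi> P) [2, 3, 4] \<longleftrightarrow> \<not> star_condition \<alpha> P)"
proof -
  let ?w = "\<pi> P" and ?J1 = "derived_system J"
  let ?J2 = "derived_system ?J1"
  note w = in_W[OF assms]
  have cor: "corank_at J ?w = 2" "corank_at ?J1 ?w = 3"
    by (simp_all add: corank_at_def dim_J[OF w] dim_derived_J[OF w])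
  have sb: "subbundle_near J ?w" "subbundle_near ?J1 ?w"
    using subbundle_near_derived_J[OF w] smooth_frame open_W w by (auto simp: subbundle_near_def)
  have ne: "J ?w \<noteq> ?J1 ?w" using dim_J[OF w] dim_derived_J[OF w] by auto
  have dim0: "dim {0 :: (real ^ 4) \<Rightarrow>\<^sub>L real} = 0"
    using dim_span_eq_card_independent[OF independent_empty] by (simp only: span_empty card.empty)
  have iff: "?J1 ?w = ?J2 ?w \<longleftrightarrow> star_condition \<alpha> P"
    using second_derived_J[OF assms] dim_derived_J[OF w] dim0 by (metis one_neq_zero)
  have "star_condition \<alpha> P" if type: "derived_type_at J ?w [2, 3]"
  proof -
    obtain N where N: "(derived_system ^^ N) J ?w = (derived_system ^^ Suc N) J ?w"
      "[2, 3] = map (\<lambda>k. corank_at ((derived_system ^^ k) J) ?w) [0..<Suc N]"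
      using type unfolding derived_type_at_def by (elim exE conjE) (rule that)
    \<comment> \<open>The list of coranks has \<open>N + 1\<close> entries, so its length determines
      \<open>N\<close>.\<close>
    have "N = 1" using arg_cong[OF N(2), of length] by simp
    with N(1) have "?J1 ?w = ?J2 ?w" by (simp only: funpow.simps One_nat_def o_apply id_apply)
    then show ?thesis using iff by blast
  qed
  moreover have "\<not> star_condition \<alpha> P" if type: "derived_type_at J ?w [2, 3, 4]"
  proof -
    obtain N where N: "\<forall>k<N. (derived_system ^^ k) J ?w \<noteq> (derived_system ^^ Suc k) J ?w"
      "[2, 3, 4] = map (\<lambda>k. corank_at ((derived_system ^^ k) J) ?w) [0..<Suc N]"
      using type unfolding derived_type_at_def by (elim exE conjE) (rule that)
    have "N = 2" using arg_cong[OF N(2), of length] by simp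
    then have "?J1 ?w \<noteq> ?J2 ?w" using spec[OF N(1), of 1] by simp
    then show ?thesis using iff by blast
  qed
  \<comment> \<open>Stabilisation concerns the fibre at \<open>?w\<close> alone, so the star
    condition at the single point \<open>P\<close> suffices with \<open>N = 1\<close>.\<close>
  moreover have "derived_type_at J ?w [2, 3]" if "star_condition \<alpha> P"
    unfolding derived_type_at_def
    by (rule exI[of _ 1]) (use that iff ne sb cor in \<open>auto simp: le_Suc_eq\<close>)
  moreover have "derived_type_at J ?w [2, 3, 4]" if ns: "\<not> star_condition \<alpha> P"
  proof -
    obtain N where N: "open N" "?w \<in> N" "\<And>w. w \<in> N \<Longrightarrow> ?J2 w = {0}"
      using second_derived_J_zero_nearby[OF assms ns] by blast
    \<comment> \<open>The zero bundle is framed by the empty list.\<close>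
    have sb2: "subbundle_near ?J2 ?w"
      unfolding subbundle_near_def smooth_frame_on_def
      by (intro exI[of _ N] exI[of _ "[]"]) (use N independent_empty in auto)
    \<comment> \<open>The zero section puts 0 into the third derived fibre, which therefore equals
      the zero second fibre, and the sequence stops at \<open>N = 2\<close>.\<close>
    have "two_form_zero_mod (?J2 ?w) (ext_deriv (one_form (\<lambda>w. 0)) ?w)"
      by (subst two_form_zero_mod_ext_deriv_iff[of "{}"]) (auto simp: N ext_deriv_pair_def)
    then have "0 \<in> derived_system ?J2 ?w"
      unfolding derived_system_def[of ?J2]
      using N by (auto intro!: exI[of _ "\<lambda>w. 0"] exI[of _ N] smooth_on_const)
    then have J3: "derived_system ?J2 ?w = ?J2 ?w"
      using derived_system_subset[of ?J2 ?w] N by auto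
    have cor2: "corank_at ?J2 ?w = 4" using N by (simp add: corank_at_def dim0)
    show ?thesis
      unfolding derived_type_at_def
      by (rule exI[of _ 2])
        (use ns iff ne sb sb2 cor cor2 J3 in \<open>auto simp: le_Suc_eq less_Suc_eq numeral_2_eq_2\<close>)
  qed
  ultimately show ?thesis by blast
qed

end

theorem theorem5p5:
  fixes \<alpha> :: "jet \<Rightarrow> real" and U V :: "jet set" and p0 :: jet
    and \<pi> :: "jet \<Rightarrow> real ^ 4" and W :: "(real ^ 4) set"
    and J :: "real ^ 4 \<Rightarrow> ((real ^ 4) \<Rightarrow>\<^sub>L real) set"
  assumes "open U" and "smooth_on U \<alpha>"
    and "involutive_type_on U \<alpha>" and "generic_type_on U \<alpha>"
    and "p0 \<in> V" and "V \<subseteq> U"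
    and "reduction \<alpha> V \<pi> W J"
  shows "(derived_type_at J (\<pi> p0) [2, 3] \<longleftrightarrow> star_condition \<alpha> p0) \<and>
    (derived_type_at J (\<pi> p0) [2, 3, 4] \<longleftrightarrow> \<not> star_condition \<alpha> p0)"
proof -
  interpret jet_reduction \<alpha> U V \<pi> W J
    using assms by unfold_locales
  show ?thesis using derived_type[OF \<open>p0 \<in> V\<close>] .
qed

end
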